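(* Let $M=M_N$ be positive integers with $M\le N$, $M\to\infty$ and $M/N\to 0$ as $N\to\infty$. Let $(\lambda_1,\ldots,\lambda_M)\in\mathbb{R}^M$ be random with joint law having density proportional to $$\prod_{i=1}^M\lambda_i^{2(N-M)}\prod_{1\le i<j\le M}|\lambda_i-\lambda_j|^2\prod_{i=1}^M e^{-N\lambda_i^2/2}$$ with respect to Lebesgue measure on $\mathbb{R}^M$, and let $L_M=\frac1M\sum_{i=1}^M\delta_{\lambda_i}$. Then $L_M$ satisfies a large deviation principle on $\mathcal{M}(\mathbb{R})$ with speed $NM$ and good rate function $$I(\mu)=\int\left(\frac12x^2-\log x^2\right)d\mu(x)-(1-\log 2).$$ The minimizer of $I$ is not unique: for every $p\in[0,1]$, the measure $p\delta_{-\sqrt2}+(1-p)\delta_{\sqrt2}$ minimizes $I$.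
   Context: $\mathcal{M}(\mathbb{R})$ is the space of Borel probability measures on $\mathbb{R}$ with the weak topology, metrized by $d_{BL}(\mu,\nu)=\sup_f|\int f\,d\mu-\int f\,d\nu|$ over $f:\mathbb{R}\to\mathbb{R}$ with Lipschitz constant at most $1$ and $|f|\le 1$. By convention $-\log 0=+\infty$. Large deviation principle: a sequence of random elements of a Polish space $X$ with laws $\mu_N$ satisfies a large deviation principle with speed $a_N\to\infty$ and rate function $I$ if (a) $I:X\to[0,\infty]$ is lower semicontinuous; (b) for every open $O\subset X$, $\liminf_{N}\frac1{a_N}\log\mu_N(O)\ge-\inf_O I$; (c) for every closed $F\subset X$, $\limsup_{N}\frac1{a_N}\log\mu_N(F)\le-\inf_F I$. The rate function is good if $\{I\le C\}$ is compact for every $C\ge 0$. *)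

theory Defs
  imports "HOL-Probability.Probability"
begin

text \<open>Only used at nonnegative arguments.\<close>

definition elog :: "real \<Rightarrow> ereal" where
  "elog x = (if x = 0 then -\<infinity> else ereal (ln x))"

definition borel_of :: "'a topology \<Rightarrow> 'a measure" where
  "borel_of X = sigma (topspace X) {U. openin X U}"

definition rate_function :: "'a topology \<Rightarrow> ('a \<Rightarrow> ereal) \<Rightarrow> bool" where
  "rate_function X I \<longleftrightarrow>
     (\<forall>x\<in>topspace X. 0 \<le> I x) \<and>
     (\<forall>c. closedin X {x \<in> topspace X. I x \<le> c})"

definition good_rate_function :: "'a topology \<Rightarrow> ('a \<Rightarrow> ereal) \<Rightarrow> bool" where
  "good_rate_function X I \<longleftrightarrow>
     rate_function X I \<and>
     (\<forall>C::real. 0 \<le> C \<longrightarrow> compactin X {x \<in> topspace X. I x \<le> ereal C})"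

text \<open>Sequences of laws are indexed by the positive integers; the entry at index 0 plays no role.\<close>

definition satisfies_ldp ::
    "'a topology \<Rightarrow> (nat \<Rightarrow> 'a measure) \<Rightarrow> (nat \<Rightarrow> real) \<Rightarrow> ('a \<Rightarrow> ereal) \<Rightarrow> bool" where
  "satisfies_ldp X \<mu> a I \<longleftrightarrow>
     (\<forall>N\<ge>1. prob_space (\<mu> N) \<and> sets (\<mu> N) = sets (borel_of X)) \<and>
     filterlim a at_top sequentially \<and>
     rate_function X I \<and>
     (\<forall>U. openin X U \<longrightarrow>
        liminf (\<lambda>N. ereal (1 / a N) * elog (measure (\<mu> N) U)) \<ge> - (INF x\<in>U. I x)) \<and>
     (\<forall>F. closedin X F \<longrightarrow>
        limsup (\<lambda>N. ereal (1 / a N) * elog (measure (\<mu> N) F)) \<le> - (INF x\<in>F. I x))"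

abbreviation real_prob_measures :: "real measure set" where
  "real_prob_measures \<equiv> space (prob_algebra borel)"

lemma real_prob_measures_iff: "\<mu> \<in> real_prob_measures \<longleftrightarrow> real_distribution \<mu>"
  by (auto simp: space_prob_algebra real_distribution_def real_distribution_axioms_def)

text \<open>Off the probability measures the distance is set to 0, since the locale
  \<^locale>\<open>Metric_space\<close> asks for nonnegativity and symmetry on the whole type.\<close>

definition dBL :: "real measure \<Rightarrow> real measure \<Rightarrow> real" where
  "dBL \<mu> \<nu> =
     (if \<mu> \<in> real_prob_measures \<and> \<nu> \<in> real_prob_measures
      then SUP f\<in>{f :: real \<Rightarrow> real. 1-lipschitz_on UNIV f \<and> (\<forall>x. \<bar>f x\<bar> \<le> 1)}.
             \<bar>(\<integral>x. f x \<partial>\<mu>) - (\<integral>x. f x \<partial>\<nu>)\<bar>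
      else 0)"

definition prob_topology :: "real measure topology" where
  "prob_topology = Metric_space.mtopology real_prob_measures dBL"

abbreviation (input) BL1 :: "(real \<Rightarrow> real) set" where
  "BL1 \<equiv> {f. 1-lipschitz_on UNIV f \<and> (\<forall>x. \<bar>f x\<bar> \<le> 1)}"

lemma BL1_integral_bound:
  assumes "\<mu> \<in> real_prob_measures" and "f \<in> BL1"
  shows "\<bar>\<integral>x. f x \<partial>\<mu>\<bar> \<le> 1"
proof -
  interpret real_distribution \<mu> using assms(1) by (simp add: real_prob_measures_iff)
  have "continuous_on UNIV f"
    using assms(2) by (auto intro: lipschitz_on_continuous_on)
  then have [measurable]: "f \<in> borel_measurable borel"
    by (rule borel_measurable_continuous_onI)
  have int: "integrable \<mu> f"
    by (rule integrable_const_bound[of _ 1]) (use assms(2) in auto)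
  have "expectation f \<le> 1"
    using assms(2) by (intro integral_le_const int) (auto simp: abs_le_iff)
  moreover have "-1 \<le> expectation f"
    using assms(2) by (intro integral_ge_const int) (auto simp: abs_le_iff minus_le_iff)
  ultimately show ?thesis by simp
qed

lemma BL1_nonempty: "(\<lambda>x. 0) \<in> BL1"
  by (auto simp: lipschitz_on_def)

lemma dBL_bdd_above:
  assumes "\<mu> \<in> real_prob_measures" "\<nu> \<in> real_prob_measures"
  shows "bdd_above ((\<lambda>f. \<bar>(\<integral>x. f x \<partial>\<mu>) - (\<integral>x. f x \<partial>\<nu>)\<bar>) ` BL1)"
proof (rule bdd_aboveI2[of _ _ 2])
  fix f assume "f \<in> BL1"
  from BL1_integral_bound[OF assms(1) this] BL1_integral_bound[OF assms(2) this]
  show "\<bar>(\<integral>x. f x \<partial>\<mu>) - (\<integral>x. f x \<partial>\<nu>)\<bar> \<le> 2" by linarith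
qed

lemma dBL_upper:
  assumes "\<mu> \<in> real_prob_measures" "\<nu> \<in> real_prob_measures" "f \<in> BL1"
  shows "\<bar>(\<integral>x. f x \<partial>\<mu>) - (\<integral>x. f x \<partial>\<nu>)\<bar> \<le> dBL \<mu> \<nu>"
  unfolding dBL_def using assms by (auto intro!: cSUP_upper dBL_bdd_above)

lemma cts_step_BL1:
  assumes "x < y"
  shows "(\<lambda>t. min 1 (y - x) * cts_step x y t) \<in> BL1"
proof -
  define c where "c = min 1 (y - x)"
  have c: "0 < c" "c \<le> 1" "c \<le> y - x" using assms by (auto simp: c_def)
  have rep: "cts_step x y t = max 0 (min 1 ((y - t) / (y - x)))" for t
    using assms by (auto simp: cts_step_def field_simps max_def min_def)
  have "\<bar>c * cts_step x y s - c * cts_step x y t\<bar> \<le> \<bar>s - t\<bar>" for s t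
  proof -
    have "\<bar>cts_step x y s - cts_step x y t\<bar> \<le> \<bar>(y - s) / (y - x) - (y - t) / (y - x)\<bar>"
      unfolding rep by linarith
    also have "\<dots> = \<bar>s - t\<bar> / (y - x)"
      using assms by (simp add: diff_divide_distrib[symmetric] abs_minus_commute)
    finally have "c * \<bar>cts_step x y s - cts_step x y t\<bar> \<le> (y - x) * (\<bar>s - t\<bar> / (y - x))"
      using c assms by (intro mult_mono) auto
    then show ?thesis
      using c assms by (simp add: right_diff_distrib[symmetric] abs_mult)
  qed
  moreover have "\<bar>c * cts_step x y t\<bar> \<le> 1" for t
  proof -
    have "0 \<le> cts_step x y t" "cts_step x y t \<le> 1" unfolding rep by auto
    then show ?thesis using c by (simp add: abs_mult mult_le_one)
  qed
  ultimately show ?thesis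
    unfolding c_def[symmetric] by (auto simp: lipschitz_on_def dist_real_def)
qed

lemma dBL_zero_cdf_le:
  assumes "\<mu> \<in> real_prob_measures" "\<nu> \<in> real_prob_measures" "dBL \<mu> \<nu> = 0"
  shows "cdf \<mu> x \<le> cdf \<nu> x"
proof -
  interpret M: real_distribution \<mu> using assms(1) by (simp add: real_prob_measures_iff)
  interpret N: real_distribution \<nu> using assms(2) by (simp add: real_prob_measures_iff)
  have "cdf \<mu> x \<le> cdf \<nu> y" if "x < y" for y
  proof -
    have "(\<integral>t. min 1 (y - x) * cts_step x y t \<partial>\<mu>) = (\<integral>t. min 1 (y - x) * cts_step x y t \<partial>\<nu>)"
      using dBL_upper[OF assms(1,2) cts_step_BL1[OF that]] assms(3) by linarith
    then have "integral\<^sup>L \<mu> (cts_step x y) = integral\<^sup>L \<nu> (cts_step x y)"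
      using that by (auto simp: min_def split: if_splits)
    then show ?thesis
      using M.cdf_cts_step(1)[OF that] N.cdf_cts_step(2)[OF that] by simp
  qed
  moreover have "(cdf \<nu> \<longlongrightarrow> cdf \<nu> x) (at_right x)"
    using N.cdf_is_right_cont[of x] by (simp add: continuous_within)
  ultimately show ?thesis
    by (intro tendsto_lowerbound[of "cdf \<nu>" _ "at_right x"])
       (auto simp: eventually_at_right_less eventually_at_filter)
qed

lemma Metric_space_dBL: "Metric_space real_prob_measures dBL"
proof
  fix \<mu> \<nu> :: "real measure"
  show "0 \<le> dBL \<mu> \<nu>"
  proof (cases "\<mu> \<in> real_prob_measures \<and> \<nu> \<in> real_prob_measures")
    case True
    then show ?thesis using dBL_upper[OF _ _ BL1_nonempty, of \<mu> \<nu>] by simp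
  qed (auto simp: dBL_def)
  show "dBL \<mu> \<nu> = dBL \<nu> \<mu>"
    by (simp add: dBL_def abs_minus_commute conj_commute)
next
  fix \<mu> \<nu> :: "real measure"
  assume P: "\<mu> \<in> real_prob_measures" "\<nu> \<in> real_prob_measures"
  show "dBL \<mu> \<nu> = 0 \<longleftrightarrow> \<mu> = \<nu>"
  proof
    assume 0: "dBL \<mu> \<nu> = 0"
    have "dBL \<nu> \<mu> = dBL \<mu> \<nu>" by (simp add: dBL_def abs_minus_commute conj_commute)
    with 0 have "dBL \<nu> \<mu> = 0" by simp
    then have "cdf \<mu> = cdf \<nu>"
      using dBL_zero_cdf_le[OF P 0] dBL_zero_cdf_le[OF P(2,1)] by (intro ext antisym) auto
    then show "\<mu> = \<nu>"
      using P by (intro cdf_unique) (auto simp: real_prob_measures_iff)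
  next
    assume "\<mu> = \<nu>"
    then show "dBL \<mu> \<nu> = 0"
      using BL1_nonempty by (auto simp: dBL_def intro!: cSUP_const)
  qed
next
  fix \<mu> \<nu> \<rho> :: "real measure"
  assume P: "\<mu> \<in> real_prob_measures" "\<nu> \<in> real_prob_measures" "\<rho> \<in> real_prob_measures"
  have "(SUP f\<in>BL1. \<bar>(\<integral>x. f x \<partial>\<mu>) - (\<integral>x. f x \<partial>\<rho>)\<bar>) \<le> dBL \<mu> \<nu> + dBL \<nu> \<rho>"
  proof (rule cSUP_least)
    show "BL1 \<noteq> {}" using BL1_nonempty by blast
    fix f assume "f \<in> BL1"
    from dBL_upper[OF P(1,2) this] dBL_upper[OF P(2,3) this]
    show "\<bar>(\<integral>x. f x \<partial>\<mu>) - (\<integral>x. f x \<partial>\<rho>)\<bar> \<le> dBL \<mu> \<nu> + dBL \<nu> \<rho>" by linarith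
  qed
  then show "dBL \<mu> \<rho> \<le> dBL \<mu> \<nu> + dBL \<nu> \<rho>"
    using P by (simp add: dBL_def[of \<mu> \<rho>])
qed

lemma topspace_prob_topology [simp]: "topspace prob_topology = real_prob_measures"
  by (simp add: prob_topology_def Metric_space.topspace_mtopology Metric_space_dBL)

definition empirical_measure :: "nat \<Rightarrow> (nat \<Rightarrow> real) \<Rightarrow> real measure" where
  "empirical_measure m x =
     measure_of UNIV (sets borel) (\<lambda>A. ennreal (1 / real m) * (\<Sum>i=1..m. indicator A (x i)))"

definition ensemble_weight :: "nat \<Rightarrow> nat \<Rightarrow> (nat \<Rightarrow> real) \<Rightarrow> real" where
  "ensemble_weight N m x =
     (\<Prod>i=1..m. x i ^ (2 * (N - m))) *
     (\<Prod>i=1..m. \<Prod>j=i+1..m. \<bar>x i - x j\<bar> ^ 2) *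
     (\<Prod>i=1..m. exp (- real N * (x i)^2 / 2))"

definition ensemble :: "nat \<Rightarrow> nat \<Rightarrow> (nat \<Rightarrow> real) measure" where
  "ensemble N m =
     (let R = (\<Pi>\<^sub>M i\<in>{1..m}. lborel)
      in density R (\<lambda>x. ennreal (ensemble_weight N m x) /
                       (\<integral>\<^sup>+ y. ennreal (ensemble_weight N m y) \<partial>R)))"

definition empirical_law :: "nat \<Rightarrow> nat \<Rightarrow> real measure measure" where
  "empirical_law N m = distr (ensemble N m) (borel_of prob_topology) (empirical_measure m)"

lemma emeasure_empirical_measure:
  assumes "A \<in> sets borel"
  shows "emeasure (empirical_measure m x) A =
           ennreal (1 / real m) * (\<Sum>i=1..m. indicator A (x i))"
proof -
  let ?\<mu> = "\<lambda>A::real set. ennreal (1 / real m) * (\<Sum>i=1..m. indicator A (x i))"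
  have "countably_additive (sets (borel :: real measure)) ?\<mu>"
  proof (rule countably_additiveI)
    fix B :: "nat \<Rightarrow> real set"
    assume "disjoint_family B"
    then have "(\<Sum>k. indicator (B k) t) = (indicator (\<Union>k. B k) t :: ennreal)" for t
      by (rule suminf_indicator)
    then show "(\<Sum>k. ?\<mu> (B k)) = ?\<mu> (\<Union>k. B k)"
      by (simp add: suminf_sum)
  qed
  then show ?thesis
    unfolding empirical_measure_def
    by (intro emeasure_measure_of_sigma)
       (use assms sets.sigma_algebra_axioms[of "borel :: real measure"] in \<open>auto simp: positive_def\<close>)
qed

lemma empirical_measure_in_real_prob_measures:
  assumes "1 \<le> m"
  shows "empirical_measure m x \<in> real_prob_measures"
proof -
  have s: "sets (empirical_measure m x) = sets borel" "space (empirical_measure m x) = UNIV"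
    using sets.sigma_sets_eq[of "borel :: real measure"]
    by (auto simp: empirical_measure_def sets_measure_of_conv space_measure_of_conv)
  have "ennreal (1 / real m) * of_nat m = 1"
    using assms by (simp add: ennreal_of_nat_eq_real_of_nat ennreal_mult[symmetric])
  then have "prob_space (empirical_measure m x)"
    using emeasure_empirical_measure[of UNIV m x] by (intro prob_spaceI) (simp add: s)
  with s show ?thesis by (simp add: space_prob_algebra)
qed

text \<open>The Lebesgue integral of an extended real function as the difference of the integrals of its
  positive and negative parts (note that \<^const>\<open>e2ennreal\<close> maps negative numbers to 0).\<close>

definition quasi_integral :: "'a measure \<Rightarrow> ('a \<Rightarrow> ereal) \<Rightarrow> ereal" where
  "quasi_integral \<mu> f =
     enn2ereal (\<integral>\<^sup>+ x. e2ennreal (f x) \<partial>\<mu>) - enn2ereal (\<integral>\<^sup>+ x. e2ennreal (- f x) \<partial>\<mu>)"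

definition I_rate :: "real measure \<Rightarrow> ereal" where
  "I_rate \<mu> = quasi_integral \<mu> (\<lambda>x. ereal (x^2 / 2) - elog (x^2)) - ereal (1 - ln 2)"

definition mixture :: "real \<Rightarrow> real measure \<Rightarrow> real measure \<Rightarrow> real measure" where
  "mixture p \<mu> \<nu> =
     measure_of UNIV (sets borel)
       (\<lambda>A. ennreal p * emeasure \<mu> A + ennreal (1 - p) * emeasure \<nu> A)"

lemma emeasure_mixture:
  assumes "A \<in> sets borel" "sets \<mu> = sets borel" "sets \<nu> = sets borel"
  shows "emeasure (mixture p \<mu> \<nu>) A = ennreal p * emeasure \<mu> A + ennreal (1 - p) * emeasure \<nu> A"
proof -
  let ?\<rho> = "\<lambda>A. ennreal p * emeasure \<mu> A + ennreal (1 - p) * emeasure \<nu> A"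
  have "countably_additive (sets (borel :: real measure)) ?\<rho>"
  proof (rule countably_additiveI)
    fix B :: "nat \<Rightarrow> real set"
    assume "range B \<subseteq> sets borel" "disjoint_family B"
    then have "(\<Sum>k. emeasure \<mu> (B k)) = emeasure \<mu> (\<Union>k. B k)"
        "(\<Sum>k. emeasure \<nu> (B k)) = emeasure \<nu> (\<Union>k. B k)"
      using assms by (auto intro!: suminf_emeasure)
    then show "(\<Sum>k. ?\<rho> (B k)) = ?\<rho> (\<Union>k. B k)"
      by (simp add: suminf_add[symmetric])
  qed
  then show ?thesis
    unfolding mixture_def
    by (intro emeasure_measure_of_sigma)
       (use assms sets.sigma_algebra_axioms[of "borel :: real measure"] in \<open>auto simp: positive_def\<close>)
qed

end

theory Submission
  imports Defs
begin

text \<open>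
Up to the Vandermonde factor, the weight of a configuration \<open>x\<close> is \<open>exp (- N m E)\<close>, where
\<open>E\<close> is the integral of \<open>V(t) = t^2/2 - log t^2\<close> against the empirical measure \<open>L\<close> of \<open>x\<close>: the
exponent \<open>2(N - m)\<close> of \<open>\<bar>x i\<bar>\<close> may be read as \<open>2N\<close> because \<open>m/N\<close> tends to 0. The Vandermonde
factor involves only about \<open>m^2\<close> pairs. It is at most \<open>exp (O(m^2))\<close> for bounded configurations and at
least \<open>exp (- O(m^2))\<close> for well separated ones, which is invisible at speed \<open>N m\<close>, as is the volume of
a box with sides of order \<open>1/m\<close>. What remains is a linear functional of the empirical measure. Its
minimum \<open>1 - log 2\<close>, the minimum of \<open>V\<close>, is the exponential rate of the partition function. Since \<open>V\<close>
is minimal at both of \<open>\<plusminus>\<surd>2\<close>, all mixtures of the two point masses are minimisers.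

Upper bound (\<open>mass_le\<close>). From \<open>(s - t)^2 \<le> (1 + s^2)(1 + t^2)\<close>, the Vandermonde factor splits into
factors \<open>(1 + t^2)^m\<close> for the single points. Sacrificing a fraction \<open>\<delta>\<close> of the potential pays for
them and still leaves a Gaussian that makes the integral converge. As \<open>V\<close> is integrated against
the empirical measure itself, this bounds the mass of an arbitrary set of measures by the infimum
of the energy over that set.

Lower bound (\<open>mass_ge\<close>). Given \<open>\<mu>\<close> of finite energy, there are nondecreasing points \<open>y i\<close>, one in each
\<open>1/m\<close>-quantile block, whose mean potential hardly exceeds the energy of \<open>\<mu>\<close>
(\<open>exists_quantile_points\<close>); their empirical measures converge to \<open>\<mu>\<close>. Moving the \<open>i\<close>-th
point by about \<open>r i/m\<close>, always away from the origin, gives boxes on which the \<open>i\<close>-th and the \<open>j\<close>-th coordinate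
differ by at least a multiple of \<open>(j - i)/m\<close>. Since the product of \<open>d/m\<close> over \<open>d \<le> m\<close> is at least \<open>exp (- m)\<close>, the
Vandermonde factor is then at least \<open>exp (- O(m^2))\<close>. A uniform separation of order
\<open>1/m\<close> alone would not suffice: it loses \<open>exp (- O(m^2 log m))\<close>, and \<open>m log m\<close> may exceed \<open>N\<close>. Moving
outwards only lowers \<open>- log t^2\<close>, so the singularity of the potential at 0 does no harm.

Goodness of the rate function (\<open>good_rate_function_I_rate\<close>) is soft: \<open>V\<close> is continuous with values
in \<open>[0, \<infinity>]\<close> and grows at infinity, so Fatou's lemma along a Skorohod coupling gives lower
semicontinuity, Markov's inequality gives tightness, and Helly's selection theorem gives compactness. For this the
topology of the bounded Lipschitz metric is identified with weak convergence of distributions.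
\<close>

section \<open>The bounded Lipschitz metric and weak convergence\<close>

interpretation BL: Metric_space real_prob_measures dBL
  rewrites "BL.mtopology = prob_topology"
  by (rule Metric_space_dBL) (simp add: prob_topology_def)

lemma dBL_le:
  assumes "\<mu> \<in> real_prob_measures" "\<nu> \<in> real_prob_measures"
    and "\<And>f. f \<in> BL1 \<Longrightarrow> \<bar>(\<integral>x. f x \<partial>\<mu>) - (\<integral>x. f x \<partial>\<nu>)\<bar> \<le> e"
  shows "dBL \<mu> \<nu> \<le> e"
  unfolding dBL_def using assms BL1_nonempty by (auto intro!: cSUP_least)

lemma BL1_measurable: "f \<in> BL1 \<Longrightarrow> f \<in> borel_measurable borel"
  by (auto intro!: borel_measurable_continuous_onI lipschitz_on_continuous_on)

lemma BL1_dist: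
  assumes "f \<in> BL1"
  shows "\<bar>f x - f y\<bar> \<le> min 2 \<bar>x - y\<bar>"
proof -
  have "\<bar>f x - f y\<bar> \<le> \<bar>x - y\<bar>"
    using assms by (auto simp: lipschitz_on_def dist_real_def)
  moreover have "\<bar>f x\<bar> \<le> 1" "\<bar>f y\<bar> \<le> 1" using assms by auto
  ultimately show ?thesis by auto
qed

text \<open>Convergence of \<open>dBL\<close> is uniform over the test functions. Skorohod's coupling provides this at once:
every test function moves by at most \<open>min 2 \<bar>X n - Y\<bar>\<close>, a bound that does not depend on the function
and tends to 0 by dominated convergence.\<close>

lemma weak_conv_imp_dBL_tendsto:
  assumes \<mu>: "\<And>n. \<mu> n \<in> real_prob_measures" and \<nu>: "\<nu> \<in> real_prob_measures"
    and conv: "weak_conv_m \<mu> \<nu>"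
  shows "(\<lambda>n. dBL (\<mu> n) \<nu>) \<longlonglongrightarrow> 0"
proof -
  obtain \<Omega> :: "real measure" and X Y where
    ps: "prob_space \<Omega>" and X: "\<forall>n. X n \<in> borel_measurable \<Omega>"
    and dX': "\<forall>n. distr \<Omega> borel (X n) = \<mu> n" and Y: "Y \<in> measurable \<Omega> lborel"
    and dY: "distr \<Omega> borel Y = \<nu>"
    and lim: "\<forall>\<omega>\<in>space \<Omega>. (\<lambda>n. X n \<omega>) \<longlonglongrightarrow> Y \<omega>"
    using Skorohod[OF \<mu>[unfolded real_prob_measures_iff] \<nu>[unfolded real_prob_measures_iff] conv]
    by blast
  have [measurable]: "X n \<in> borel_measurable \<Omega>" "Y \<in> borel_measurable \<Omega>" for n
    using X Y by simp_all
  have dX: "distr \<Omega> borel (X n) = \<mu> n" for n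
    using dX' by blast
  interpret prob_space \<Omega> by fact
  have int: "integrable \<Omega> (\<lambda>\<omega>. min 2 \<bar>X n \<omega> - Y \<omega>\<bar>)" for n
    by (rule integrable_const_bound[of _ 2]) auto
  have "(\<lambda>n. \<integral>\<omega>. min 2 \<bar>X n \<omega> - Y \<omega>\<bar> \<partial>\<Omega>) \<longlonglongrightarrow> (\<integral>\<omega>. 0 \<partial>\<Omega>)"
  proof (rule integral_dominated_convergence[where w="\<lambda>_. 2"])
    show "AE \<omega> in \<Omega>. (\<lambda>n. min 2 \<bar>X n \<omega> - Y \<omega>\<bar>) \<longlonglongrightarrow> 0"
    proof (intro AE_I2)
      fix \<omega> assume "\<omega> \<in> space \<Omega>"
      then have "(\<lambda>n. min 2 \<bar>X n \<omega> - Y \<omega>\<bar>) \<longlonglongrightarrow> min 2 \<bar>Y \<omega> - Y \<omega>\<bar>"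
        by (intro tendsto_intros lim[rule_format])
      then show "(\<lambda>n. min 2 \<bar>X n \<omega> - Y \<omega>\<bar>) \<longlonglongrightarrow> 0" by simp
    qed
  qed auto
  then have lim0: "(\<lambda>n. \<integral>\<omega>. min 2 \<bar>X n \<omega> - Y \<omega>\<bar> \<partial>\<Omega>) \<longlonglongrightarrow> 0" by simp
  have le: "dBL (\<mu> n) \<nu> \<le> (\<integral>\<omega>. min 2 \<bar>X n \<omega> - Y \<omega>\<bar> \<partial>\<Omega>)" for n
  proof (rule dBL_le[OF \<mu> \<nu>])
    fix f assume f: "f \<in> BL1"
    note [measurable] = BL1_measurable[OF f]
    have i: "integrable \<Omega> (\<lambda>\<omega>. f (X n \<omega>))" "integrable \<Omega> (\<lambda>\<omega>. f (Y \<omega>))"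
      using f by (auto intro!: integrable_const_bound[of _ 1])
    have "(\<integral>x. f x \<partial>\<mu> n) - (\<integral>x. f x \<partial>\<nu>) = (\<integral>\<omega>. f (X n \<omega>) - f (Y \<omega>) \<partial>\<Omega>)"
      unfolding dX[symmetric] dY[symmetric] using i by (simp add: integral_distr)
    also have "\<bar>\<dots>\<bar> \<le> (\<integral>\<omega>. \<bar>f (X n \<omega>) - f (Y \<omega>)\<bar> \<partial>\<Omega>)"
      by (rule integral_abs_bound)
    also have "\<dots> \<le> (\<integral>\<omega>. min 2 \<bar>X n \<omega> - Y \<omega>\<bar> \<partial>\<Omega>)"
      using i by (intro integral_mono int BL1_dist[OF f]) auto
    finally show "\<bar>(\<integral>x. f x \<partial>\<mu> n) - (\<integral>x. f x \<partial>\<nu>)\<bar> \<le> (\<integral>\<omega>. min 2 \<bar>X n \<omega> - Y \<omega>\<bar> \<partial>\<Omega>)" .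
  qed
  show ?thesis
    by (rule tendsto_sandwich[OF _ _ tendsto_const lim0]) (auto simp: le)
qed

text \<open>The piecewise linear approximations of half-line indicators are multiples of admissible test
functions, and they determine weak convergence.\<close>

lemma limitin_prob_topology_imp_weak_conv:
  assumes \<mu>: "\<And>n. \<mu> n \<in> real_prob_measures" and lim: "limitin prob_topology \<mu> \<nu> sequentially"
  shows "\<nu> \<in> real_prob_measures" "weak_conv_m \<mu> \<nu>"
proof -
  show \<nu>: "\<nu> \<in> real_prob_measures"
    using lim limitin_topspace by force
  have d0: "(\<lambda>n. dBL (\<mu> n) \<nu>) \<longlonglongrightarrow> 0"
    using lim \<mu> \<nu> unfolding BL.limit_metric_sequentially
    by (auto simp: LIMSEQ_iff abs_of_nonneg)
  show "weak_conv_m \<mu> \<nu>"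
  proof (rule integral_cts_step_conv_imp_weak_conv)
    fix x y :: real assume xy: "x < y"
    define c where "c = min 1 (y - x)"
    have c: "0 < c" using xy by (simp add: c_def)
    have "(\<lambda>n. (\<integral>t. c * cts_step x y t \<partial>\<mu> n) - (\<integral>t. c * cts_step x y t \<partial>\<nu>)) \<longlonglongrightarrow> 0"
      by (rule Lim_null_comparison[OF _ d0])
         (use dBL_upper[OF \<mu> \<nu> cts_step_BL1[OF xy]] in \<open>auto simp: c_def intro!: always_eventually\<close>)
    then have "(\<lambda>n. inverse c * (c * integral\<^sup>L (\<mu> n) (cts_step x y) - c * integral\<^sup>L \<nu> (cts_step x y))) \<longlonglongrightarrow> inverse c * 0"
      by (intro tendsto_mult_left) simp
    then have "(\<lambda>n. integral\<^sup>L (\<mu> n) (cts_step x y) - integral\<^sup>L \<nu> (cts_step x y)) \<longlonglongrightarrow> 0"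
      using c by (simp add: mult.assoc[symmetric] right_diff_distrib)
    then show "(\<lambda>n. integral\<^sup>L (\<mu> n) (cts_step x y)) \<longlonglongrightarrow> integral\<^sup>L \<nu> (cts_step x y)"
      by (rule LIM_zero_cancel)
  qed (use \<mu> \<nu> in \<open>auto simp: real_prob_measures_iff\<close>)
qed

lemma weak_conv_imp_limitin_prob_topology:
  assumes \<mu>: "\<And>n. \<mu> n \<in> real_prob_measures" and \<nu>: "\<nu> \<in> real_prob_measures"
    and conv: "weak_conv_m \<mu> \<nu>"
  shows "limitin prob_topology \<mu> \<nu> sequentially"
  using weak_conv_imp_dBL_tendsto[OF assms] \<mu> \<nu>
  unfolding BL.limit_metric_sequentially by (auto simp: LIMSEQ_iff abs_of_nonneg)

lemma sets_borel_of: "sets (borel_of X) = sigma_sets (topspace X) {U. openin X U}"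
  unfolding borel_of_def by (rule sets_measure_of) (auto dest: openin_subset)

lemma space_borel_of: "space (borel_of X) = topspace X"
  unfolding borel_of_def by (rule space_measure_of) (auto dest: openin_subset)

lemma openin_sets_borel_of: "openin X U \<Longrightarrow> U \<in> sets (borel_of X)"
  by (auto simp: sets_borel_of)

lemma closedin_sets_borel_of: 
  assumes "closedin X F" shows "F \<in> sets (borel_of X)"
proof -
  have "space (borel_of X) - (topspace X - F) \<in> sets (borel_of X)"
    using assms by (intro sets.compl_sets openin_sets_borel_of) auto
  then show ?thesis
    using closedin_subset[OF assms] by (simp add: space_borel_of double_diff)
qed

lemma sets_empirical_measure [simp, measurable_cong]: "sets (empirical_measure m x) = sets borel"
  using sets.sigma_sets_eq[of "borel :: real measure"]
  by (auto simp: empirical_measure_def sets_measure_of_conv)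

text \<open>This representation makes the transformation rules for integrals available.\<close>

lemma empirical_measure_eq_distr:
  assumes "1 \<le> m"
  shows "empirical_measure m x = distr (uniform_count_measure {1..m}) borel x"
proof (rule measure_eqI)
  fix A assume "A \<in> sets (empirical_measure m x)"
  then have A: "A \<in> sets borel" by simp
  have eq: "(\<Sum>i=1..m. indicator A (x i) :: ennreal) = of_nat (card (x -` A \<inter> {1..m}))"
    by (simp add: indicator_def sum.If_cases Int_def vimage_def conj_commute)
  have "emeasure (distr (uniform_count_measure {1..m}) borel x) A = ennreal (real (card (x -` A \<inter> {1..m})) / real m)"
    using A by (subst emeasure_distr)
      (auto simp: space_uniform_count_measure sets_uniform_count_measure emeasure_uniform_count_measure measurable_def)
  also have "\<dots> = ennreal (1 / real m) * of_nat (card (x -` A \<inter> {1..m}))"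
    by (simp add: ennreal_of_nat_eq_real_of_nat flip: ennreal_mult)
  finally show "emeasure (empirical_measure m x) A = emeasure (distr (uniform_count_measure {1..m}) borel x) A"
    by (simp only: emeasure_empirical_measure[OF A] eq)
qed simp

lemma measurable_uniform_count_measure: "x \<in> measurable (uniform_count_measure {1..m::nat}) borel"
  by (auto simp: measurable_def space_uniform_count_measure sets_uniform_count_measure)

lemma integral_empirical_measure:
  fixes f :: "real \<Rightarrow> real"
  assumes "1 \<le> m" "f \<in> borel_measurable borel"
  shows "(\<integral>t. f t \<partial>empirical_measure m x) = (\<Sum>i=1..m. f (x i)) / real m"
proof -
  have "(\<integral>t. f t \<partial>empirical_measure m x) = (\<integral>i. f (x i) \<partial>uniform_count_measure {1..m})"
    unfolding empirical_measure_eq_distr[OF assms(1)]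
    by (rule integral_distr[OF measurable_uniform_count_measure assms(2)])
  then show ?thesis
    by (subst (asm) integral_uniform_count_measure) auto
qed

lemma nn_integral_empirical_measure:
  assumes "1 \<le> m" "f \<in> borel_measurable borel"
  shows "(\<integral>\<^sup>+t. f t \<partial>empirical_measure m x) = ennreal (1 / real m) * (\<Sum>i=1..m. f (x i))"
proof -
  have "(\<integral>\<^sup>+t. f t \<partial>empirical_measure m x) = (\<integral>\<^sup>+i. f (x i) \<partial>uniform_count_measure {1..m})"
    unfolding empirical_measure_eq_distr[OF assms(1)]
    by (rule nn_integral_distr[OF measurable_uniform_count_measure]) (simp add: assms(2))
  also have "\<dots> = (\<Sum>i=1..m. ennreal (1 / real m) * f (x i))"
    unfolding uniform_count_measure_def by (subst nn_integral_point_measure_finite) auto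
  finally show ?thesis
    by (simp only: sum_distrib_left)
qed

lemma dBL_empirical_measure_le:
  assumes m: "1 \<le> m" and close: "\<And>i. i \<in> {1..m} \<Longrightarrow> \<bar>x i - y i\<bar> \<le> e"
  shows "dBL (empirical_measure m x) (empirical_measure m y) \<le> e"
proof (rule dBL_le[OF empirical_measure_in_real_prob_measures[OF m] empirical_measure_in_real_prob_measures[OF m]])
  fix f assume f: "f \<in> BL1"
  have "\<bar>(\<Sum>i=1..m. f (x i)) - (\<Sum>i=1..m. f (y i))\<bar> \<le> (\<Sum>i=1..m. \<bar>f (x i) - f (y i)\<bar>)"
    by (simp flip: sum_subtractf)
  also have "\<dots> \<le> (\<Sum>i=1..m. e)"
  proof (rule sum_mono)
    fix i assume "i \<in> {1..m}"
    then show "\<bar>f (x i) - f (y i)\<bar> \<le> e"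
      using close[of i] BL1_dist[OF f, of "x i" "y i"] by linarith
  qed
  also have "\<dots> = real m * e" by simp
  finally have "\<bar>(\<Sum>i=1..m. f (x i)) - (\<Sum>i=1..m. f (y i))\<bar> / real m \<le> e"
    using m by (subst pos_divide_le_eq) (auto simp: mult.commute)
  then show "\<bar>(\<integral>t. f t \<partial>empirical_measure m x) - (\<integral>t. f t \<partial>empirical_measure m y)\<bar> \<le> e"
    by (simp only: integral_empirical_measure[OF m BL1_measurable[OF f]] diff_divide_distrib[symmetric] abs_divide abs_of_nat)
qed

text \<open>The empirical measure is continuous in the configuration. The Borel sets of \<open>nat \<Rightarrow> real\<close> restrict
to the product sigma-algebra on the finitely many coordinates, since off \<open>{1..m}\<close> every point of the
product space has the constant value \<open>undefined\<close>.\<close>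

lemma measurable_empirical_measure:
  assumes m: "1 \<le> m"
  shows "empirical_measure m \<in> measurable (\<Pi>\<^sub>M i\<in>{1..m}. lborel) (borel_of prob_topology)"
proof -
  have open_vimage: "open {x :: nat \<Rightarrow> real. empirical_measure m x \<in> U}" if U: "openin prob_topology U" for U
  proof (subst open_subopen, intro ballI)
    fix x assume "x \<in> {x. empirical_measure m x \<in> U}"
    then obtain e where e: "0 < e" "BL.mball (empirical_measure m x) e \<subseteq> U"
      using U by (auto simp: BL.openin_mtopology)
    \<comment> \<open>half the radius in each coordinate, since the coordinatewise bound on \<open>dBL\<close> is not strict\<close>
    define T where "T = (\<Inter>i\<in>{1..m}. {z :: nat \<Rightarrow> real. dist (z i) (x i) < e / 2})"
    have "open {z :: nat \<Rightarrow> real. dist (z i) (x i) < e / 2}" for i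
      by (intro open_Collect_less continuous_intros continuous_on_product_coordinates)
    then have "open T" unfolding T_def by (intro open_INT) auto
    moreover have "x \<in> T" using e by (simp add: T_def)
    moreover have "empirical_measure m z \<in> U" if "z \<in> T" for z
    proof -
      have "\<bar>x i - z i\<bar> \<le> e / 2" if "i \<in> {1..m}" for i
      proof -
        have "z \<in> {z. dist (z i) (x i) < e / 2}" using that \<open>z \<in> T\<close> unfolding T_def by blast
        then show ?thesis by (simp add: dist_real_def abs_minus_commute)
      qed
      then have "dBL (empirical_measure m x) (empirical_measure m z) \<le> e / 2"
        by (intro dBL_empirical_measure_le[OF m])
      then have "dBL (empirical_measure m x) (empirical_measure m z) < e"
        using e by linarith
      then have "empirical_measure m z \<in> BL.mball (empirical_measure m x) e"
        using empirical_measure_in_real_prob_measures[OF m] by (simp only: BL.in_mball)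
      then show ?thesis using e by blast
    qed
    ultimately show "\<exists>T. open T \<and> x \<in> T \<and> T \<subseteq> {x. empirical_measure m x \<in> U}" by blast
  qed
  have id: "(\<lambda>x. x) \<in> measurable (\<Pi>\<^sub>M i\<in>{1..m}. lborel) (borel :: (nat \<Rightarrow> real) measure)"
  proof (subst measurable_cong_sets[OF refl sets_PiM_equal_borel[symmetric]], rule measurable_PiM_single')
    fix i :: nat
    show "(\<lambda>x. x i) \<in> borel_measurable (\<Pi>\<^sub>M i\<in>{1..m}. (lborel :: real measure))"
    proof (cases "i \<in> {1..m}")
      case True
      then show ?thesis using measurable_component_singleton[OF True, of "\<lambda>_. lborel :: real measure"] by simp
    next
      case False
      have "(\<lambda>x. x i) \<in> borel_measurable (\<Pi>\<^sub>M i\<in>{1..m}. (lborel :: real measure)) \<longleftrightarrow>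
        (\<lambda>x. undefined :: real) \<in> borel_measurable (\<Pi>\<^sub>M i\<in>{1..m}. (lborel :: real measure))"
        using False by (intro measurable_cong) (auto simp: space_PiM PiE_def extensional_def)
      then show ?thesis by simp
    qed
  qed auto
  show ?thesis
    unfolding borel_of_def
  proof (rule measurable_measure_of)
    show "{U. openin prob_topology U} \<subseteq> Pow (topspace prob_topology)"
      using openin_subset[of prob_topology] by blast
    show "empirical_measure m \<in> space (\<Pi>\<^sub>M i\<in>{1..m}. lborel) \<rightarrow> topspace prob_topology"
      using empirical_measure_in_real_prob_measures[OF m] by simp
    fix U assume "U \<in> {U. openin prob_topology U}"
    then have "{x. empirical_measure m x \<in> U} \<in> sets borel"
      using open_vimage by (intro borel_open) auto
    from measurable_sets[OF id this]
    show "empirical_measure m -` U \<inter> space (\<Pi>\<^sub>M i\<in>{1..m}. lborel) \<in> sets (\<Pi>\<^sub>M i\<in>{1..m}. lborel)"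
      by (simp add: vimage_def)
  qed
qed

section \<open>The rate function\<close>

text \<open>The integrand of the rate function. It is positive, so that its integral is always
defined in \<open>ennreal\<close>.\<close>

definition potential :: "real \<Rightarrow> ennreal" where
  "potential x = e2ennreal (ereal (x^2 / 2) - elog (x^2))"

definition energy :: "real measure \<Rightarrow> ennreal" where
  "energy \<mu> = (\<integral>\<^sup>+ x. potential x \<partial>\<mu>)"

lemma potential_0 [simp]: "potential 0 = \<infinity>"
  by (simp add: potential_def elog_def)

lemma potential_nonzero: "x \<noteq> 0 \<Longrightarrow> potential x = ennreal (x^2 / 2 - ln (x^2))"
  by (simp add: potential_def elog_def ennreal.abs_eq)

text \<open>Tangent line of \<open>ln\<close> at \<open>2\<close>, where the potential, as a function of \<open>x^2\<close>, is minimal.\<close>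

lemma real_potential_ge_min:
  fixes x :: real assumes "x \<noteq> 0" shows "1 - ln 2 \<le> x^2 / 2 - ln (x^2)"
proof -
  have "ln (x^2 / 2) \<le> x^2 / 2 - 1" using assms by (intro ln_le_minus_one) auto
  moreover have "ln (x^2 / 2) = ln (x^2) - ln 2" using assms by (simp add: ln_div)
  ultimately show ?thesis by linarith
qed

text \<open>Tangent line of \<open>ln\<close> at \<open>4\<close>, which leaves half of the quadratic term for tightness and for the
comparison of second moments with energies.\<close>

lemma real_potential_ge_quadratic:
  fixes x :: real assumes "x \<noteq> 0" shows "x^2 / 4 - 1 \<le> x^2 / 2 - ln (x^2)"
proof -
  have "ln (x^2 / 4) \<le> x^2 / 4 - 1" using assms by (intro ln_le_minus_one) auto
  moreover have "ln (x^2 / 4) = ln (x^2) - 2 * ln 2" using assms by (simp add: ln_div ln_realpow[of 2 2, simplified])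
  ultimately show ?thesis using ln_2_less_1 by linarith
qed

lemma min_potential_pos: "0 < 1 - ln (2 :: real)"
  using ln_2_less_1 by simp

lemma potential_ge_min: "ennreal (1 - ln 2) \<le> potential x"
  by (cases "x = 0") (auto simp: potential_nonzero intro!: ennreal_leI real_potential_ge_min)

lemma potential_ge_quadratic: "ennreal (x^2 / 4 - 1) \<le> potential x"
  by (cases "x = 0") (auto simp: potential_nonzero intro!: ennreal_leI real_potential_ge_quadratic)

lemma measurable_potential [measurable]: "potential \<in> borel_measurable borel"
  unfolding potential_def[abs_def] elog_def by measurable

lemma tendsto_potential:
  assumes "X \<longlonglongrightarrow> x"
  shows "(\<lambda>n. potential (X n)) \<longlonglongrightarrow> potential x"
proof (cases "x = 0")
  case False
  have ev: "eventually (\<lambda>n. X n \<noteq> 0) sequentially"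
    using tendsto_imp_eventually_ne[OF assms False] .
  have "(\<lambda>n. ennreal ((X n)^2 / 2 - ln ((X n)^2))) \<longlonglongrightarrow> ennreal (x^2 / 2 - ln (x^2))"
    using False by (intro tendsto_intros assms) auto
  then show ?thesis
    unfolding potential_nonzero[OF False]
    by (rule Lim_transform_eventually) (use ev in eventually_elim, simp add: potential_nonzero)
next
  case True
  have "eventually (\<lambda>n. ennreal c < potential (X n)) sequentially" if "0 \<le> c" for c :: real
  proof -
    have "eventually (\<lambda>n. \<bar>X n\<bar> < exp (- c - 1)) sequentially"
      using order_tendstoD(2)[OF tendsto_rabs[OF assms], of "exp (- c - 1)"] True by simp
    then show ?thesis
    proof eventually_elim
      case (elim n)
      show ?case
      proof (cases "X n = 0")
        case False
        have "ln \<bar>X n\<bar> < ln (exp (- c - 1))"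
          using elim False by (subst ln_less_cancel_iff) auto
        moreover have "ln ((X n)^2) = 2 * ln \<bar>X n\<bar>"
          using False by (subst power2_abs[symmetric], subst ln_realpow) auto
        ultimately have "c < (X n)^2 / 2 - ln ((X n)^2)"
          using zero_le_power2[of "X n"] that by (simp only: ln_exp)
        then show ?thesis using that by (simp add: potential_nonzero[OF False] ennreal_lessI)
      qed simp
    qed
  qed
  then have "eventually (\<lambda>n. a < potential (X n)) sequentially" if "a < \<infinity>" for a
    using that by (cases a) auto
  then show ?thesis using True by (intro order_tendstoI) auto
qed

lemma e2ennreal_minus_potential: "e2ennreal (- (ereal (x^2 / 2) - elog (x^2))) = 0"
proof (cases "x = 0")
  case False
  then have "- (x^2 / 2 - ln (x^2)) \<le> 0"
    using real_potential_ge_min[OF False] min_potential_pos by linarith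
  then have "ereal (- (x^2 / 2 - ln (x^2))) \<le> 0" by simp
  moreover have "- (ereal (x^2 / 2) - elog (x^2)) = ereal (- (x^2 / 2 - ln (x^2)))"
    using False by (simp add: elog_def)
  ultimately show ?thesis by (simp only: e2ennreal_neg)
qed (simp add: elog_def e2ennreal_neg)

lemma I_rate_eq: "I_rate \<mu> = enn2ereal (energy \<mu>) - ereal (1 - ln 2)"
  unfolding I_rate_def quasi_integral_def energy_def potential_def
  by (simp add: e2ennreal_minus_potential zero_ennreal.rep_eq del: uminus_ereal.simps)

lemma energy_ge_min:
  assumes "\<mu> \<in> real_prob_measures"
  shows "ennreal (1 - ln 2) \<le> energy \<mu>"
proof -
  interpret real_distribution \<mu> using assms by (simp add: real_prob_measures_iff)
  have "(\<integral>\<^sup>+ x. ennreal (1 - ln 2) \<partial>\<mu>) \<le> energy \<mu>"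
    unfolding energy_def by (intro nn_integral_mono potential_ge_min)
  then show ?thesis using emeasure_space_1 by simp
qed

lemma I_rate_nonneg:
  assumes "\<mu> \<in> real_prob_measures"
  shows "0 \<le> I_rate \<mu>"
proof -
  have "enn2ereal (ennreal (1 - ln 2)) \<le> enn2ereal (energy \<mu>)"
    using energy_ge_min[OF assms] by (simp only: less_eq_ennreal.rep_eq)
  then show ?thesis
    using min_potential_pos by (cases "enn2ereal (energy \<mu>)") (auto simp: I_rate_eq enn2ereal_ennreal)
qed

lemma I_rate_le_iff: "I_rate \<mu> \<le> ereal c \<longleftrightarrow> enn2ereal (energy \<mu>) \<le> ereal (c + (1 - ln 2))"
  unfolding I_rate_eq by (cases "enn2ereal (energy \<mu>)") (auto simp: algebra_simps)

text \<open>Fatou's lemma along an almost surely convergent coupling, by continuity of the potential up to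
and including its pole.\<close>

lemma energy_le_liminf:
  assumes \<mu>: "\<And>n. \<mu> n \<in> real_prob_measures" and \<nu>: "\<nu> \<in> real_prob_measures"
    and conv: "weak_conv_m \<mu> \<nu>"
  shows "energy \<nu> \<le> liminf (\<lambda>n. energy (\<mu> n))"
proof -
  obtain \<Omega> :: "real measure" and X Y where
    ps: "prob_space \<Omega>" and X: "\<forall>n. X n \<in> borel_measurable \<Omega>"
    and dX: "\<forall>n. distr \<Omega> borel (X n) = \<mu> n" and Y: "Y \<in> measurable \<Omega> lborel"
    and dY: "distr \<Omega> borel Y = \<nu>"
    and lim: "\<forall>\<omega>\<in>space \<Omega>. (\<lambda>n. X n \<omega>) \<longlonglongrightarrow> Y \<omega>"
    using Skorohod[OF \<mu>[unfolded real_prob_measures_iff] \<nu>[unfolded real_prob_measures_iff] conv]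
    by blast
  have [measurable]: "X n \<in> borel_measurable \<Omega>" "Y \<in> borel_measurable \<Omega>" for n
    using X Y by simp_all
  have "energy \<nu> = (\<integral>\<^sup>+ \<omega>. potential (Y \<omega>) \<partial>\<Omega>)"
    unfolding energy_def dY[symmetric] by (rule nn_integral_distr) simp_all
  also have "\<dots> = (\<integral>\<^sup>+ \<omega>. liminf (\<lambda>n. potential (X n \<omega>)) \<partial>\<Omega>)"
    using lim by (intro nn_integral_cong lim_imp_Liminf[symmetric] tendsto_potential) auto
  also have "\<dots> \<le> liminf (\<lambda>n. \<integral>\<^sup>+ \<omega>. potential (X n \<omega>) \<partial>\<Omega>)"
    by (rule nn_integral_liminf) simp
  also have "(\<lambda>n. \<integral>\<^sup>+ \<omega>. potential (X n \<omega>) \<partial>\<Omega>) = (\<lambda>n. energy (\<mu> n))"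
    unfolding energy_def dX[rule_format, symmetric] by (intro ext nn_integral_distr[symmetric]) simp_all
  finally show ?thesis .
qed

lemma energy_limit_le:
  assumes \<mu>: "\<And>n. \<mu> n \<in> real_prob_measures" and \<nu>: "\<nu> \<in> real_prob_measures"
    and conv: "weak_conv_m \<mu> \<nu>" and le: "\<And>n. energy (\<mu> n) \<le> c"
  shows "energy \<nu> \<le> c"
proof -
  have "liminf (\<lambda>n. energy (\<mu> n)) \<le> liminf (\<lambda>n::nat. c)"
    by (intro Liminf_mono always_eventually allI le)
  with energy_le_liminf[OF assms(1-3)] show ?thesis by (simp add: Liminf_const)
qed

lemma closedin_energy_le: "closedin prob_topology {\<mu> \<in> real_prob_measures. energy \<mu> \<le> c}"
  unfolding BL.metric_closedin_iff_sequentially_closed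
proof (intro conjI allI impI)
  fix \<sigma> \<nu> assume *: "range \<sigma> \<subseteq> {\<mu> \<in> real_prob_measures. energy \<mu> \<le> c} \<and> limitin prob_topology \<sigma> \<nu> sequentially"
  then have "\<sigma> n \<in> {\<mu> \<in> real_prob_measures. energy \<mu> \<le> c}" for n by blast
  then have \<sigma>: "\<sigma> n \<in> real_prob_measures" "energy (\<sigma> n) \<le> c" for n by blast+
  have l: "limitin prob_topology \<sigma> \<nu> sequentially" using * by (rule conjunct2)
  have \<nu>: "\<nu> \<in> real_prob_measures" and conv: "weak_conv_m \<sigma> \<nu>"
    using limitin_prob_topology_imp_weak_conv[of \<sigma> \<nu>, OF \<sigma>(1) l] by this+
  have "energy \<nu> \<le> c"
    by (rule energy_limit_le[of \<sigma> \<nu>, OF \<sigma>(1) \<nu> conv \<sigma>(2)])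
  with \<nu> show "\<nu> \<in> {\<mu> \<in> real_prob_measures. energy \<mu> \<le> c}"
    by (intro CollectI conjI)
qed (rule Collect_restrict)

text \<open>Markov's inequality for the quadratic minorant of the potential.\<close>

lemma measure_tail_le:
  assumes \<mu>: "\<mu> \<in> real_prob_measures" and le: "energy \<mu> \<le> ennreal c" and c: "0 \<le> c" and R: "2 < R"
  shows "measure \<mu> (- {-R<..R}) \<le> c / (R^2 / 4 - 1)"
proof -
  interpret real_distribution \<mu> using \<mu> by (simp add: real_prob_measures_iff)
  define k where "k = R^2 / 4 - 1"
  have "2^2 < R^2" using R by (intro power_strict_mono) auto
  then have k: "0 < k" by (simp add: k_def)
  have "ennreal (k * measure \<mu> (- {-R<..R})) = ennreal k * emeasure \<mu> (- {-R<..R})"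
    using k by (simp add: emeasure_eq_measure ennreal_mult)
  also have "\<dots> = (\<integral>\<^sup>+ x. ennreal k * indicator (- {-R<..R}) x \<partial>\<mu>)"
    by (rule nn_integral_cmult_indicator[symmetric]) simp
  also have "\<dots> \<le> energy \<mu>"
    unfolding energy_def
  proof (rule nn_integral_mono)
    fix x
    have "ennreal k \<le> potential x" if "x \<notin> {-R<..R}"
    proof -
      have "R^2 \<le> \<bar>x\<bar>^2" using that R by (intro power_mono) auto
      then have "ennreal k \<le> ennreal (x^2 / 4 - 1)" by (auto intro!: ennreal_leI simp: k_def)
      also note potential_ge_quadratic
      finally show ?thesis .
    qed
    then show "ennreal k * indicator (- {-R<..R}) x \<le> potential x"
      by (auto split: split_indicator)
  qed
  finally have "ennreal (k * measure \<mu> (- {-R<..R})) \<le> ennreal c" using le by simp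
  then have "k * measure \<mu> (- {-R<..R}) \<le> c" using c by simp
  then show ?thesis using k by (simp add: pos_le_divide_eq mult.commute flip: k_def)
qed

lemma tight_energy_le:
  assumes \<mu>: "\<And>n. \<mu> n \<in> real_prob_measures" and le: "\<And>n. energy (\<mu> n) \<le> ennreal c" and c: "0 \<le> c"
  shows "tight \<mu>"
  unfolding tight_def
proof (intro conjI allI impI)
  fix n show "real_distribution (\<mu> n)" using \<mu>[of n] by (simp add: real_prob_measures_iff)
next
  fix e :: real assume e: "0 < e"
  \<comment> \<open>chosen so that \<open>R^2 / 4 - 1 = 1 + c / e\<close>\<close>
  define R where "R = 2 * sqrt (2 + c / e)"
  have ce: "0 \<le> c / e" using c e by simp
  have R2: "R^2 = 4 * (2 + c / e)" using ce by (simp add: R_def power_mult_distrib)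
  have "sqrt 1 < sqrt (2 + c / e)" using ce by (intro real_sqrt_less_mono) linarith
  then have R: "2 < R" by (simp add: R_def)
  have "1 - e < measure (\<mu> n) {-R<..R}" for n
  proof -
    interpret real_distribution "\<mu> n" using \<mu>[of n] by (simp add: real_prob_measures_iff)
    have "measure (\<mu> n) (- {-R<..R}) \<le> c / (1 + c / e)"
      using measure_tail_le[OF \<mu> le c R, of n] by (simp add: R2 add_divide_distrib)
    also have "\<dots> < e"
      using ce e by (subst pos_divide_less_eq) (auto simp: distrib_left)
    finally show ?thesis
      using prob_compl[of "{-R<..R}"] by (simp add: Compl_eq_Diff_UNIV)
  qed
  moreover have "-R < R" using R by simp
  ultimately show "\<exists>a b. a < b \<and> (\<forall>n. 1 - e < measure (\<mu> n) {a<..b})" by blast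
qed

lemma compactin_energy_le:
  assumes c: "0 \<le> c"
  shows "compactin prob_topology {\<mu> \<in> real_prob_measures. energy \<mu> \<le> ennreal c}"
  unfolding BL.compactin_sequentially
proof (intro conjI allI impI)
  fix \<sigma> :: "nat \<Rightarrow> real measure"
  assume "range \<sigma> \<subseteq> {\<mu> \<in> real_prob_measures. energy \<mu> \<le> ennreal c}"
  then have "\<sigma> n \<in> {\<mu> \<in> real_prob_measures. energy \<mu> \<le> ennreal c}" for n by blast
  then have \<sigma>: "\<sigma> n \<in> real_prob_measures" "energy (\<sigma> n) \<le> ennreal c" for n by blast+
  have id: "strict_mono (id :: nat \<Rightarrow> nat)" by (simp add: strict_mono_def)
  obtain r \<nu> where r: "strict_mono r" and \<nu>: "real_distribution \<nu>" and conv: "weak_conv_m (\<sigma> \<circ> id \<circ> r) \<nu>"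
    using tight_imp_convergent_subsubsequence[of \<sigma> id, OF tight_energy_le[of \<sigma>, OF \<sigma> c] id] by blast
  have \<nu>': "\<nu> \<in> real_prob_measures" using \<nu> by (simp add: real_prob_measures_iff)
  have conv': "weak_conv_m (\<sigma> \<circ> r) \<nu>" using conv by simp
  have s: "(\<sigma> \<circ> r) n \<in> real_prob_measures" "energy ((\<sigma> \<circ> r) n) \<le> ennreal c" for n
    using \<sigma> by (simp_all only: comp_apply)
  show "\<exists>l r. l \<in> {\<mu> \<in> real_prob_measures. energy \<mu> \<le> ennreal c} \<and> strict_mono r \<and>
      limitin prob_topology (\<sigma> \<circ> r) l sequentially"
  proof (intro exI conjI)
    have "energy \<nu> \<le> ennreal c"
      by (rule energy_limit_le[of "\<sigma> \<circ> r" \<nu>, OF s(1) \<nu>' conv' s(2)])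
    with \<nu>' show "\<nu> \<in> {\<mu> \<in> real_prob_measures. energy \<mu> \<le> ennreal c}"
      by (intro CollectI conjI)
    show "limitin prob_topology (\<sigma> \<circ> r) \<nu> sequentially"
      by (rule weak_conv_imp_limitin_prob_topology[of "\<sigma> \<circ> r" \<nu>, OF s(1) \<nu>' conv'])
  qed (fact r)
qed (rule Collect_restrict)

text \<open>Subtracting \<open>1 - ln 2\<close> in \<open>ereal\<close> becomes an addition on the other side, which can be done in \<open>ennreal\<close>.\<close>

lemma sublevel_I_rate:
  "{\<mu> \<in> real_prob_measures. I_rate \<mu> \<le> ereal c} = {\<mu> \<in> real_prob_measures. energy \<mu> \<le> ennreal (c + (1 - ln 2))}"
  if "0 \<le> c"
proof -
  have "enn2ereal (energy \<mu>) \<le> ereal (c + (1 - ln 2)) \<longleftrightarrow> energy \<mu> \<le> ennreal (c + (1 - ln 2))" for \<mu>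
    using that min_potential_pos by (simp only: less_eq_ennreal.rep_eq) (subst enn2ereal_ennreal, linarith, rule refl)
  then show ?thesis by (simp only: I_rate_le_iff)
qed

lemma good_rate_function_I_rate: "good_rate_function prob_topology I_rate"
  unfolding good_rate_function_def rate_function_def topspace_prob_topology
proof (intro conjI ballI allI impI)
  fix c :: ereal
  show "closedin prob_topology {\<mu> \<in> real_prob_measures. I_rate \<mu> \<le> c}"
  proof (cases "c < 0")
    case True
    have "\<not> I_rate \<mu> \<le> c" if "\<mu> \<in> real_prob_measures" for \<mu>
      using order.strict_trans2[OF True I_rate_nonneg[OF that]] by (simp only: not_le)
    then have "{\<mu> \<in> real_prob_measures. I_rate \<mu> \<le> c} = {}" by blast
    then show ?thesis by (simp only: closedin_empty)
  next
    case False
    show ?thesis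
    proof (cases c)
      case (real r)
      with False have "0 \<le> r" by simp
      then show ?thesis unfolding real by (simp only: sublevel_I_rate closedin_energy_le)
    next
      case PInf
      have "{\<mu> \<in> real_prob_measures. I_rate \<mu> \<le> c} = topspace prob_topology" using PInf by simp
      then show ?thesis by (simp only: closedin_topspace)
    next
      case MInf
      with False show ?thesis by simp
    qed
  qed
next
  fix C :: real assume C: "0 \<le> C"
  then show "compactin prob_topology {\<mu> \<in> real_prob_measures. I_rate \<mu> \<le> ereal C}"
    unfolding sublevel_I_rate[OF C] using min_potential_pos by (intro compactin_energy_le) linarith
qed (rule I_rate_nonneg)

lemma energy_empirical_measure:
  assumes "1 \<le> m"
  shows "energy (empirical_measure m x) = ennreal (1 / real m) * (\<Sum>i=1..m. potential (x i))"
  unfolding energy_def by (rule nn_integral_empirical_measure[OF assms]) simp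

lemma energy_empirical_measure_nonzero:
  assumes "1 \<le> m" and nz: "\<And>i. i \<in> {1..m} \<Longrightarrow> x i \<noteq> 0"
  shows "energy (empirical_measure m x) = ennreal ((\<Sum>i=1..m. (x i)^2 / 2 - ln ((x i)^2)) / real m)"
proof -
  have nn: "0 \<le> (x i)^2 / 2 - ln ((x i)^2)" if "i \<in> {1..m}" for i
    using real_potential_ge_min[OF nz[OF that]] min_potential_pos by linarith
  have "(\<Sum>i=1..m. potential (x i)) = (\<Sum>i=1..m. ennreal ((x i)^2 / 2 - ln ((x i)^2)))"
    using nz by (intro sum.cong refl potential_nonzero)
  also have "\<dots> = ennreal (\<Sum>i=1..m. (x i)^2 / 2 - ln ((x i)^2))"
    using nn by (rule sum_ennreal)
  finally have s: "(\<Sum>i=1..m. potential (x i)) = ennreal (\<Sum>i=1..m. (x i)^2 / 2 - ln ((x i)^2))" .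
  have "0 \<le> (\<Sum>i=1..m. (x i)^2 / 2 - ln ((x i)^2))"
    using nn by (rule sum_nonneg)
  then show ?thesis
    unfolding energy_empirical_measure[OF assms(1)] s by (simp add: ennreal_mult[symmetric])
qed

lemma mixture_in_real_prob_measures:
  assumes "p \<in> {0..1}" "\<mu> \<in> real_prob_measures" "\<nu> \<in> real_prob_measures"
  shows "mixture p \<mu> \<nu> \<in> real_prob_measures"
proof -
  have s: "sets (mixture p \<mu> \<nu>) = sets borel" "space (mixture p \<mu> \<nu>) = UNIV"
    using sets.sigma_sets_eq[of "borel :: real measure"]
    by (auto simp: mixture_def sets_measure_of_conv space_measure_of_conv)
  interpret M: real_distribution \<mu> using assms(2) by (simp add: real_prob_measures_iff)
  interpret N: real_distribution \<nu> using assms(3) by (simp add: real_prob_measures_iff)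
  have "emeasure (mixture p \<mu> \<nu>) UNIV = ennreal p + ennreal (1 - p)"
    using M.emeasure_space_1 N.emeasure_space_1 by (simp add: emeasure_mixture)
  also have "\<dots> = 1" using assms(1) by (simp flip: ennreal_plus)
  finally have "prob_space (mixture p \<mu> \<nu>)" by (intro prob_spaceI) (simp add: s)
  with s show ?thesis by (simp add: space_prob_algebra)
qed

lemma return_in_real_prob_measures: "return borel x \<in> real_prob_measures" for x :: real
  by (simp add: space_prob_algebra prob_space_return)

lemma energy_two_point:
  assumes "p \<in> {0..1}"
  shows "energy (mixture p (return borel (- sqrt 2)) (return borel (sqrt 2))) = ennreal (1 - ln 2)"
    (is "energy ?\<mu> = _")
proof -
  interpret real_distribution ?\<mu>
    using mixture_in_real_prob_measures[OF assms return_in_real_prob_measures return_in_real_prob_measures]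
    by (simp add: real_prob_measures_iff)
  have "emeasure ?\<mu> (- {- sqrt 2, sqrt 2}) = 0"
    by (subst emeasure_mixture) (auto simp: indicator_def)
  then have "AE x in ?\<mu>. x \<in> {- sqrt 2, sqrt 2}"
    by (intro AE_I[of _ _ "- {- sqrt 2, sqrt 2}"]) auto
  then have "AE x in ?\<mu>. potential x = ennreal (1 - ln 2)"
    by eventually_elim (auto simp: potential_nonzero)
  then have "energy ?\<mu> = (\<integral>\<^sup>+ x. ennreal (1 - ln 2) \<partial>?\<mu>)"
    unfolding energy_def by (rule nn_integral_cong_AE)
  then show ?thesis using emeasure_space_1 by simp
qed

lemma two_point_is_arg_min:
  assumes "p \<in> {0..1}"
  shows "is_arg_min I_rate (\<lambda>\<mu>. \<mu> \<in> real_prob_measures) (mixture p (return borel (- sqrt 2)) (return borel (sqrt 2)))"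
proof -
  have "I_rate (mixture p (return borel (- sqrt 2)) (return borel (sqrt 2))) = 0"
    unfolding I_rate_eq energy_two_point[OF assms] using min_potential_pos by (simp add: enn2ereal_ennreal)
  then show ?thesis
    using mixture_in_real_prob_measures[OF assms return_in_real_prob_measures return_in_real_prob_measures] I_rate_nonneg
    by (auto simp: is_arg_min_def not_less)
qed

lemma two_point_distinct:
  "mixture 0 (return borel (- sqrt 2)) (return borel (sqrt 2)) \<noteq> mixture 1 (return borel (- sqrt 2)) (return borel (sqrt 2))"
proof
  assume "mixture 0 (return borel (- sqrt 2)) (return borel (sqrt 2)) = mixture 1 (return borel (- sqrt 2)) (return borel (sqrt 2))"
  then have "emeasure (mixture 0 (return borel (- sqrt 2)) (return borel (sqrt 2))) {0<..}
    = emeasure (mixture 1 (return borel (- sqrt 2)) (return borel (sqrt 2))) {0<..}" by simp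
  then show False by (simp add: emeasure_mixture)
qed

section \<open>Upper bounds for the ensemble weight\<close>

lemma prod_pairs_Suc:
  fixes f :: "nat \<Rightarrow> nat \<Rightarrow> 'a :: comm_monoid_mult"
  shows "(\<Prod>i=1..Suc m. \<Prod>j=i+1..Suc m. f i j) = (\<Prod>i=1..m. \<Prod>j=i+1..m. f i j) * (\<Prod>i=1..m. f i (Suc m))"
proof -
  have "(\<Prod>i=1..Suc m. \<Prod>j=i+1..Suc m. f i j) = (\<Prod>i=1..m. \<Prod>j=i+1..Suc m. f i j)"
    by simp
  also have "\<dots> = (\<Prod>i=1..m. (\<Prod>j=i+1..m. f i j) * f i (Suc m))"
    by (intro prod.cong refl) simp
  finally show ?thesis by (simp only: prod.distrib)
qed

text \<open>Each pair contributes at most \<open>(1 + s^2)(1 + t^2)\<close>, and each point belongs to fewer than \<open>m\<close> pairs.\<close>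

lemma vandermonde_sq_le:
  fixes x :: "nat \<Rightarrow> real"
  shows "(\<Prod>i=1..m. \<Prod>j=i+1..m. \<bar>x i - x j\<bar> ^ 2) \<le> (\<Prod>i=1..m. (1 + (x i)^2) ^ m)"
proof (induction m)
  case (Suc m)
  have pair: "\<bar>s - t\<bar> ^ 2 \<le> (1 + s^2) * (1 + t^2)" for s t :: real
  proof -
    have "(1 + s^2) * (1 + t^2) - (s - t)^2 = (1 + s * t)^2"
      by (simp add: power2_eq_square algebra_simps)
    then show ?thesis using zero_le_power2[of "1 + s * t"] by (simp only: power2_abs)
  qed
  have "(\<Prod>i=1..Suc m. \<Prod>j=i+1..Suc m. \<bar>x i - x j\<bar> ^ 2)
      \<le> (\<Prod>i=1..m. (1 + (x i)^2) ^ m) * (\<Prod>i=1..m. (1 + (x i)^2) * (1 + (x (Suc m))^2))"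
    unfolding prod_pairs_Suc
    by (intro mult_mono Suc.IH prod_mono prod_nonneg conjI pair ballI) auto
  also have "\<dots> = (\<Prod>i=1..m. (1 + (x i)^2) ^ Suc m) * (1 + (x (Suc m))^2) ^ m"
    by (simp add: prod.distrib mult_ac)
  also have "\<dots> \<le> (\<Prod>i=1..m. (1 + (x i)^2) ^ Suc m) * (1 + (x (Suc m))^2) ^ Suc m"
    by (intro mult_left_mono power_increasing prod_nonneg) auto
  also have "\<dots> = (\<Prod>i=1..Suc m. (1 + (x i)^2) ^ Suc m)"
    by simp
  finally show ?case .
qed simp

lemma ensemble_weight_le_prod:
  "ensemble_weight N m x \<le> (\<Prod>i=1..m. (x i)^(2 * (N - m)) * (1 + (x i)^2)^m * exp (- real N * (x i)^2 / 2))"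
  unfolding ensemble_weight_def prod.distrib
  by (intro mult_right_mono mult_left_mono vandermonde_sq_le prod_nonneg) auto

lemma even_power_eq_exp:
  fixes t :: real assumes "t \<noteq> 0"
  shows "t ^ (2 * k) = exp (real k * ln (t^2))"
  using assms by (simp add: power_mult exp_of_nat_mult)

lemma ln_one_plus_sq_le: "ln (1 + t^2) \<le> t^2 / 4 + (1 :: real)"
proof -
  have "0 < 1 + t^2" by (simp add: add_pos_nonneg)
  then have "ln ((1 + t^2) / 4) \<le> (1 + t^2) / 4 - 1" by (intro ln_le_minus_one) auto
  moreover have "ln ((1 + t^2) / 4) = ln (1 + t^2) - 2 * ln 2"
    using \<open>0 < 1 + t^2\<close> by (simp add: ln_div ln_realpow[of 2 2, simplified])
  ultimately show ?thesis using ln2_le_25_over_36 by argo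
qed

text \<open>The factor \<open>(1 + t^2)^m\<close> from the Vandermonde determinant and the \<open>m\<close> missing powers of \<open>t^2\<close> are
absorbed by giving up the fraction \<open>\<delta>\<close> of the potential. For \<open>m \<le> \<delta> N\<close> the remaining coefficient of
\<open>ln (t^2)\<close> is nonnegative, so that \<open>ln (t^2)\<close> can be replaced by \<open>ln (1 + t^2) \<le> t^2 / 4 + 1\<close>, and a
Gaussian survives.\<close>

lemma site_weight_le:
  fixes t :: real
  assumes t: "t \<noteq> 0" and m: "m \<le> N" "real m \<le> \<delta> * real N"
  shows "t^(2 * (N - m)) * (1 + t^2)^m * exp (- real N * t^2 / 2)
    \<le> exp (- real N * ((1 - \<delta>) * (t^2 / 2 - ln (t^2)) + \<delta> * (t^2 / 4 - 1)))"
proof -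
  have pos: "0 < 1 + t^2" by (simp add: add_pos_nonneg)
  have "(1 + t^2)^m = exp (real m * ln (1 + t^2))"
    using pos by (simp add: exp_of_nat_mult)
  then have eq: "t^(2 * (N - m)) * (1 + t^2)^m * exp (- real N * t^2 / 2)
      = exp (real (N - m) * ln (t^2) + real m * ln (1 + t^2) - real N * t^2 / 2)"
    by (simp add: even_power_eq_exp[OF t] mult_exp_exp)
  have "ln (t^2) \<le> ln (1 + t^2)" using t pos by simp
  then have "(\<delta> * real N - real m) * ln (t^2) \<le> (\<delta> * real N - real m) * ln (1 + t^2)"
    using m by (intro mult_left_mono) auto
  moreover have "\<delta> * real N * ln (1 + t^2) \<le> \<delta> * real N * (t^2 / 4 + 1)"
    using m by (intro mult_left_mono ln_one_plus_sq_le) (meson of_nat_0_le_iff order_trans)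
  ultimately have "(\<delta> * real N - real m) * ln (t^2) + real m * ln (1 + t^2) \<le> \<delta> * real N * (t^2 / 4 + 1)"
    by (simp only: left_diff_distrib)
  then have "real (N - m) * ln (t^2) + real m * ln (1 + t^2) - real N * t^2 / 2
    \<le> - real N * ((1 - \<delta>) * (t^2 / 2 - ln (t^2)) + \<delta> * (t^2 / 4 - 1))"
    using m by (simp add: of_nat_diff algebra_simps diff_divide_distrib)
  then show ?thesis unfolding eq by simp
qed

text \<open>The case \<open>\<delta> = 1\<close> keeps nothing of the potential. It covers all sizes up to \<open>m = N\<close> and suffices for
the finiteness of the partition function.\<close>

lemma site_weight_le_gaussian:
  fixes t :: real
  assumes m: "m \<le> N"
  shows "t^(2 * (N - m)) * (1 + t^2)^m * exp (- real N * t^2 / 2) \<le> exp (- real N * (t^2 / 4 - 1))"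
proof (cases "t = 0")
  case False
  from site_weight_le[OF this m, of 1] m show ?thesis by simp
qed (simp add: power_0_left)

lemma nn_integral_gaussian:
  assumes "0 < \<delta>"
  shows "(\<integral>\<^sup>+t. ennreal (exp (- \<delta> * t^2 / 4)) \<partial>lborel) = ennreal (sqrt (4 * pi / \<delta>))"
proof -
  have eq: "exp (- \<delta> * t^2 / 4) = sqrt (4 * pi / \<delta>) * normal_density 0 (sqrt (2 / \<delta>)) t" for t
    using assms by (simp add: normal_density_def field_simps)
  have "(\<integral>\<^sup>+t. ennreal (normal_density 0 (sqrt (2 / \<delta>)) t) \<partial>lborel) = 1"
    using assms by (subst nn_integral_eq_integral) auto
  then show ?thesis
    unfolding eq using assms by (simp add: ennreal_mult nn_integral_cmult)
qed

interpretation lborel_prod: product_sigma_finite "\<lambda>_::nat. lborel :: real measure" ..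

text \<open>The unnormalised law of the empirical measure; its total mass is the partition function.\<close>

definition mass :: "nat \<Rightarrow> nat \<Rightarrow> real measure set \<Rightarrow> ennreal" where
  "mass N m U = (\<integral>\<^sup>+ x. ennreal (ensemble_weight N m x) * indicator U (empirical_measure m x)
     \<partial>(\<Pi>\<^sub>M i\<in>{1..m}. lborel))"

lemma nn_integral_gaussian_prod:
  assumes "0 < \<delta>" "1 \<le> N"
  shows "(\<integral>\<^sup>+ x. (\<Prod>i=1..m. ennreal (exp (- real N * \<delta> * (x i)^2 / 4))) \<partial>(\<Pi>\<^sub>M i\<in>{1..m}. lborel))
    \<le> ennreal (sqrt (4 * pi / \<delta>) ^ m)"
proof -
  have "(\<integral>\<^sup>+ x. (\<Prod>i=1..m. ennreal (exp (- real N * \<delta> * (x i)^2 / 4))) \<partial>(\<Pi>\<^sub>M i\<in>{1..m}. lborel))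
    \<le> (\<integral>\<^sup>+ x. (\<Prod>i=1..m. ennreal (exp (- \<delta> * (x i)^2 / 4))) \<partial>(\<Pi>\<^sub>M i\<in>{1..m}. lborel))"
  proof (rule nn_integral_mono)
    fix x :: "nat \<Rightarrow> real"
    have "exp (- real N * \<delta> * t^2 / 4) \<le> exp (- \<delta> * t^2 / 4)" for t :: real
    proof -
      have "1 * (\<delta> * t^2) \<le> real N * (\<delta> * t^2)" using assms by (intro mult_right_mono) auto
      then show ?thesis by (simp add: mult.assoc)
    qed
    then have "ennreal (\<Prod>i=1..m. exp (- real N * \<delta> * (x i)^2 / 4)) \<le> ennreal (\<Prod>i=1..m. exp (- \<delta> * (x i)^2 / 4))"
      by (intro ennreal_leI prod_mono) auto
    then show "(\<Prod>i=1..m. ennreal (exp (- real N * \<delta> * (x i)^2 / 4))) \<le> (\<Prod>i=1..m. ennreal (exp (- \<delta> * (x i)^2 / 4)))"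
      by (simp only: prod_ennreal exp_ge_zero)
  qed
  also have "\<dots> = (\<Prod>i=1..m. \<integral>\<^sup>+ t. ennreal (exp (- \<delta> * t^2 / 4)) \<partial>lborel)"
    by (rule lborel_prod.product_nn_integral_prod) auto
  also have "\<dots> = ennreal (sqrt (4 * pi / \<delta>) ^ m)"
    using assms unfolding nn_integral_gaussian[OF assms(1)] by (simp add: ennreal_power)
  finally show ?thesis .
qed

text \<open>The sum of the single-point bounds sees the configuration only through its energy, apart from
the Gaussian. A configuration through the origin has infinite energy, and its weight is 0 because
\<open>m < N\<close>.\<close>

lemma ensemble_weight_le_energy:
  assumes m: "1 \<le> m" "m < N" "real m \<le> \<delta> * real N" and \<delta>: "\<delta> \<le> 1"
    and c: "ennreal c \<le> energy (empirical_measure m x)"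
  shows "ensemble_weight N m x \<le> exp (- (real N * real m) * ((1 - \<delta>) * c - \<delta>)) *
    (\<Prod>i=1..m. exp (- real N * \<delta> * (x i)^2 / 4))"
proof (cases "\<exists>i\<in>{1..m}. x i = 0")
  case True
  then have "(\<Prod>i=1..m. x i ^ (2 * (N - m))) = 0" using m by (auto intro!: prod_zero simp: power_0_left)
  then have "ensemble_weight N m x = 0" by (simp only: ensemble_weight_def mult_zero_left)
  then show ?thesis by (simp only:) (intro mult_nonneg_nonneg prod_nonneg ballI exp_ge_zero)
next
  case False
  then have nz: "x i \<noteq> 0" if "i \<in> {1..m}" for i using that by blast
  define v where "v i = (x i)^2 / 2 - ln ((x i)^2)" for i
  have nn: "0 \<le> v i" if "i \<in> {1..m}" for i
    using real_potential_ge_min[OF nz[OF that]] min_potential_pos unfolding v_def by linarith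
  have e: "energy (empirical_measure m x) = ennreal ((\<Sum>i=1..m. v i) / real m)"
    unfolding v_def using m(1) nz by (intro energy_empirical_measure_nonzero)
  have "0 \<le> (\<Sum>i=1..m. v i) / real m" using nn by (auto intro!: divide_nonneg_nonneg sum_nonneg)
  then have "c \<le> (\<Sum>i=1..m. v i) / real m" using c unfolding e by (simp add: ennreal_le_iff)
  then have cm: "real m * c \<le> (\<Sum>i=1..m. v i)" using m by (simp add: pos_le_divide_eq mult.commute)
  have "ensemble_weight N m x \<le> (\<Prod>i=1..m. exp (- real N * ((1 - \<delta>) * v i + \<delta> * ((x i)^2 / 4 - 1))))"
    using nz m unfolding v_def
    by (intro order.trans[OF ensemble_weight_le_prod] prod_mono conjI site_weight_le mult_nonneg_nonneg) auto
  also have "\<dots> = exp (\<Sum>i=1..m. - real N * (1 - \<delta>) * v i + real N * \<delta> + (- real N * \<delta> * (x i)^2 / 4))"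
    by (simp add: exp_sum algebra_simps)
  also have "\<dots> = exp (- (real N * (1 - \<delta>)) * (\<Sum>i=1..m. v i) + real m * (real N * \<delta>)) * (\<Prod>i=1..m. exp (- real N * \<delta> * (x i)^2 / 4))"
    by (simp only: sum.distrib exp_add exp_sum[OF finite_atLeastAtMost] sum_distrib_left[symmetric]) simp
  also have "\<dots> \<le> exp (- (real N * (1 - \<delta>)) * (real m * c) + real m * (real N * \<delta>)) * (\<Prod>i=1..m. exp (- real N * \<delta> * (x i)^2 / 4))"
  proof (intro mult_right_mono prod_nonneg)
    have "real N * (1 - \<delta>) * (real m * c) \<le> real N * (1 - \<delta>) * (\<Sum>i=1..m. v i)"
      using cm \<delta> by (intro mult_left_mono) auto
    then show "exp (- (real N * (1 - \<delta>)) * (\<Sum>i=1..m. v i) + real m * (real N * \<delta>)) \<le> exp (- (real N * (1 - \<delta>)) * (real m * c) + real m * (real N * \<delta>))"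
      by simp
  qed auto
  also have "- (real N * (1 - \<delta>)) * (real m * c) + real m * (real N * \<delta>) = - (real N * real m) * ((1 - \<delta>) * c - \<delta>)"
    by (simp add: algebra_simps)
  finally show ?thesis .
qed

text \<open>At scale \<open>N m\<close> the Gaussian integral contributes \<open>O(1/N)\<close>.\<close>

lemma mass_le:
  assumes m: "1 \<le> m" "m < N" "real m \<le> \<delta> * real N" and \<delta>: "0 < \<delta>" "\<delta> \<le> 1"
    and c: "\<And>\<mu>. \<mu> \<in> U \<Longrightarrow> ennreal c \<le> energy \<mu>"
  shows "mass N m U \<le> ennreal (exp (- (real N * real m) * ((1 - \<delta>) * c - \<delta>)) * sqrt (4 * pi / \<delta>) ^ m)"
proof -
  define K where "K = exp (- (real N * real m) * ((1 - \<delta>) * c - \<delta>))"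
  have "mass N m U \<le> (\<integral>\<^sup>+ x. ennreal K * (\<Prod>i=1..m. ennreal (exp (- real N * \<delta> * (x i)^2 / 4))) \<partial>(\<Pi>\<^sub>M i\<in>{1..m}. lborel))"
    unfolding mass_def
  proof (rule nn_integral_mono)
    fix x :: "nat \<Rightarrow> real"
    have "ennreal (ensemble_weight N m x) \<le> ennreal K * (\<Prod>i=1..m. ennreal (exp (- real N * \<delta> * (x i)^2 / 4)))"
      if "empirical_measure m x \<in> U"
    proof -
      have "ennreal (ensemble_weight N m x) \<le> ennreal (K * (\<Prod>i=1..m. exp (- real N * \<delta> * (x i)^2 / 4)))"
        unfolding K_def by (intro ennreal_leI ensemble_weight_le_energy m \<delta> c that)
      also have "\<dots> = ennreal K * (\<Prod>i=1..m. ennreal (exp (- real N * \<delta> * (x i)^2 / 4)))"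
        by (subst ennreal_mult) (auto simp: K_def prod_ennreal intro!: prod_nonneg)
      finally show ?thesis .
    qed
    then show "ennreal (ensemble_weight N m x) * indicator U (empirical_measure m x)
      \<le> ennreal K * (\<Prod>i=1..m. ennreal (exp (- real N * \<delta> * (x i)^2 / 4)))"
      by (auto split: split_indicator)
  qed
  also have "\<dots> = ennreal K * (\<integral>\<^sup>+ x. (\<Prod>i=1..m. ennreal (exp (- real N * \<delta> * (x i)^2 / 4))) \<partial>(\<Pi>\<^sub>M i\<in>{1..m}. lborel))"
    by (intro nn_integral_cmult borel_measurable_prod_ennreal) measurable
  also have "\<dots> \<le> ennreal K * ennreal (sqrt (4 * pi / \<delta>) ^ m)"
    using m \<delta> by (intro mult_left_mono nn_integral_gaussian_prod) auto
  also have "\<dots> = ennreal (K * sqrt (4 * pi / \<delta>) ^ m)"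
    using \<delta> by (intro ennreal_mult[symmetric]) (auto simp: K_def)
  finally show ?thesis unfolding K_def .
qed

lemma mass_finite:
  assumes m: "1 \<le> m" "m \<le> N"
  shows "mass N m U < \<infinity>"
proof -
  \<comment> \<open>the factor 1 stands for \<open>\<delta> = 1\<close>, where only a Gaussian is kept\<close>
  have "mass N m U \<le> (\<integral>\<^sup>+ x. ennreal (exp (real N) ^ m) * (\<Prod>i=1..m. ennreal (exp (- real N * 1 * (x i)^2 / 4))) \<partial>(\<Pi>\<^sub>M i\<in>{1..m}. lborel))"
    unfolding mass_def
  proof (rule nn_integral_mono)
    fix x :: "nat \<Rightarrow> real"
    have "ensemble_weight N m x \<le> (\<Prod>i=1..m. exp (- real N * ((x i)^2 / 4 - 1)))"
      using m by (intro order.trans[OF ensemble_weight_le_prod] prod_mono conjI site_weight_le_gaussian mult_nonneg_nonneg) auto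
    also have "\<dots> = (\<Prod>i=1..m. exp (real N) * exp (- real N * 1 * (x i)^2 / 4))"
      by (intro prod.cong refl) (simp add: algebra_simps flip: exp_add)
    also have "\<dots> = exp (real N) ^ m * (\<Prod>i=1..m. exp (- real N * 1 * (x i)^2 / 4))"
      by (simp add: prod.distrib)
    finally have "ennreal (ensemble_weight N m x) \<le> ennreal (exp (real N) ^ m * (\<Prod>i=1..m. exp (- real N * 1 * (x i)^2 / 4)))"
      by (rule ennreal_leI)
    also have "\<dots> = ennreal (exp (real N) ^ m) * (\<Prod>i=1..m. ennreal (exp (- real N * 1 * (x i)^2 / 4)))"
      by (subst ennreal_mult) (auto simp: prod_ennreal intro!: prod_nonneg)
    finally show "ennreal (ensemble_weight N m x) * indicator U (empirical_measure m x)
      \<le> ennreal (exp (real N) ^ m) * (\<Prod>i=1..m. ennreal (exp (- real N * 1 * (x i)^2 / 4)))"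
      by (auto split: split_indicator)
  qed
  also have "\<dots> = ennreal (exp (real N) ^ m) * (\<integral>\<^sup>+ x. (\<Prod>i=1..m. ennreal (exp (- real N * 1 * (x i)^2 / 4))) \<partial>(\<Pi>\<^sub>M i\<in>{1..m}. lborel))"
    by (intro nn_integral_cmult borel_measurable_prod_ennreal) measurable
  also have "\<dots> \<le> ennreal (exp (real N) ^ m) * ennreal (sqrt (4 * pi / 1) ^ m)"
    using m by (intro mult_left_mono nn_integral_gaussian_prod) auto
  also have "\<dots> < \<infinity>" by (simp add: ennreal_mult_less_top)
  finally show ?thesis .
qed

section \<open>Lower bounds for the ensemble weight\<close>

lemma power_div_fact_le_exp: "real m ^ m / fact m \<le> exp (real m)"
proof -
  have "(\<Sum>n\<in>{m}. real m ^ n /\<^sub>R fact n) \<le> exp (real m)"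
    unfolding sums_unique[OF exp_converges[of "real m"]]
    by (rule sum_le_suminf[OF sums_summable[OF exp_converges[of "real m"]]]) auto
  then show ?thesis by (simp add: divide_inverse mult.commute)
qed

text \<open>Stirling's bound \<open>m! \<ge> (m/e)^m\<close>; truncating the product at \<open>n\<close> only drops factors that are at most 1.\<close>

lemma prod_equispaced_ge:
  assumes q: "0 < q" "q \<le> 1" and n: "n \<le> m" and m: "1 \<le> m"
  shows "(q / exp 1) ^ m \<le> (\<Prod>d=1..n. q * real d / real m)"
proof -
  have "1 / exp (real m) \<le> fact m / real m ^ m"
    using power_div_fact_le_exp[of m] m by (simp add: field_simps)
  then have "q ^ m * (1 / exp (real m)) \<le> q ^ m * (fact m / real m ^ m)"
    using q by (intro mult_left_mono) auto
  also have "\<dots> = (\<Prod>d=1..m. q * real d / real m)"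
    by (simp add: prod_dividef prod.distrib fact_prod)
  also have "\<dots> = (\<Prod>d\<in>{1..n}. q * real d / real m) * (\<Prod>d\<in>{n+1..m}. q * real d / real m)"
    using n by (subst prod.union_disjoint[symmetric]) (auto intro!: prod.cong)
  also have "\<dots> \<le> (\<Prod>d\<in>{1..n}. q * real d / real m) * 1"
  proof (intro mult_left_mono prod_le_1 prod_nonneg conjI)
    fix d assume "d \<in> {n+1..m}"
    then show "q * real d / real m \<le> 1"
      using q m by (simp add: divide_le_eq mult_le_one) (metis mult_left_le mult.commute of_nat_0_le_iff of_nat_le_iff order_trans)
  qed (use q in auto)
  finally show ?thesis
    using q by (simp add: power_divide exp_of_nat_mult[symmetric])
qed

text \<open>For each \<open>i\<close> the distances to the later points dominate the arithmetic progression
\<open>q/m, 2q/m, \<dots>\<close>. The exponent stays of order \<open>m^2\<close>, without a logarithm of \<open>m\<close>.\<close>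

lemma vandermonde_sq_ge:
  fixes x :: "nat \<Rightarrow> real"
  assumes q: "0 < q" "q \<le> 1" and m: "1 \<le> m"
    and sep: "\<And>i j. \<lbrakk>i \<in> {1..m}; j \<in> {1..m}; i < j\<rbrakk> \<Longrightarrow> q * real (j - i) / real m \<le> \<bar>x i - x j\<bar>"
  shows "(q / exp 1) ^ (2 * m^2) \<le> (\<Prod>i=1..m. \<Prod>j=i+1..m. \<bar>x i - x j\<bar> ^ 2)"
proof -
  have "(\<Prod>i=1..m. (q / exp 1) ^ (2 * m)) \<le> (\<Prod>i=1..m. \<Prod>j=i+1..m. \<bar>x i - x j\<bar> ^ 2)"
  proof (intro prod_mono conjI)
    fix i assume i: "i \<in> {1..m}"
    have "(q / exp 1) ^ m \<le> (\<Prod>d=1..m-i. q * real d / real m)"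
      using q m by (intro prod_equispaced_ge) auto
    then have "((q / exp 1) ^ m)^2 \<le> (\<Prod>d=1..m-i. q * real d / real m)^2"
      using q by (intro power_mono) auto
    also have "\<dots> = (\<Prod>d=1..m-i. (q * real d / real m)^2)"
      by (simp add: prod_power_distrib)
    also have "\<dots> = (\<Prod>j=i+1..m. (q * real (j - i) / real m)^2)"
      using i by (intro prod.reindex_bij_witness[where i="\<lambda>j. j - i" and j="\<lambda>d. d + i"]) auto
    also have "\<dots> \<le> (\<Prod>j=i+1..m. \<bar>x i - x j\<bar> ^ 2)"
      using i q by (intro prod_mono conjI power_mono sep) auto
    finally show "(q / exp 1) ^ (2 * m) \<le> (\<Prod>j=i+1..m. \<bar>x i - x j\<bar> ^ 2)"
      by (simp add: power_mult[symmetric] mult.commute)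
  qed (use q in auto)
  then show ?thesis by (simp add: power_mult[symmetric] power2_eq_square mult_ac)
qed

text \<open>The drift \<open>r i / m\<close> separates the points. The jump by \<open>2 r\<close> at negative \<open>y i\<close> makes the total
displacement point away from the origin; for nondecreasing \<open>y\<close> it decreases the earlier points only
and hence increases the gaps.\<close>

definition box_corner :: "nat \<Rightarrow> real \<Rightarrow> (nat \<Rightarrow> real) \<Rightarrow> nat \<Rightarrow> real" where
  "box_corner m r y i = y i + r * real i / real m - (if y i < 0 then 2 * r else 0)"

text \<open>Side length \<open>r / (2 m)\<close> is half the drift between consecutive points, so that boxes of different
points stay apart.\<close>

definition box_side :: "nat \<Rightarrow> real \<Rightarrow> (nat \<Rightarrow> real) \<Rightarrow> nat \<Rightarrow> real set" where
  "box_side m r y i = {box_corner m r y i .. box_corner m r y i + r / (2 * real m)}"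

lemma box_side_separated:
  assumes r: "0 < r" and m: "1 \<le> m" and mono: "mono_on {1..m} y"
    and ij: "i \<in> {1..m}" "j \<in> {1..m}" "i < j"
    and x: "x i \<in> box_side m r y i" "x j \<in> box_side m r y j"
  shows "(r / 2) * real (j - i) / real m \<le> \<bar>x i - x j\<bar>"
proof -
  have y: "y i \<le> y j" using mono ij by (auto simp: mono_on_def)
  have "box_corner m r y j - box_corner m r y i \<ge> r * real j / real m - r * real i / real m"
    using y r by (auto simp: box_corner_def)
  moreover have "r * real j / real m - r * real i / real m = r * real (j - i) / real m"
    using ij by (simp add: of_nat_diff diff_divide_distrib right_diff_distrib)
  ultimately have "r * real (j - i) / real m - r / (2 * real m) \<le> x j - x i"
    using x unfolding box_side_def atLeastAtMost_iff by linarith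
  moreover have "r / (2 * real m) * 1 \<le> r / (2 * real m) * real (j - i)"
    using r m ij by (intro mult_left_mono) auto
  ultimately show ?thesis by (simp add: field_simps)
qed

lemma box_side_bounds:
  assumes r: "0 < r" and m: "1 \<le> m" and i: "i \<in> {1..m}" and x: "x \<in> box_side m r y i"
  shows "\<bar>x - y i\<bar> \<le> 2 * r" "0 \<le> y i \<Longrightarrow> y i \<le> x" "y i < 0 \<Longrightarrow> x \<le> y i"
proof -
  have a: "0 \<le> r * real i / real m" "r * real i / real m \<le> r" "0 \<le> r / (2 * real m)" "r / (2 * real m) \<le> r"
    using r m i by (auto simp: field_simps)
  show "\<bar>x - y i\<bar> \<le> 2 * r" "0 \<le> y i \<Longrightarrow> y i \<le> x" "y i < 0 \<Longrightarrow> x \<le> y i"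
    using a x unfolding box_side_def box_corner_def atLeastAtMost_iff
    by (cases "y i < 0"; simp only: if_True if_False; linarith)+
qed

text \<open>Under a move away from the origin the logarithmic term improves and only the quadratic one grows; the
growth is controlled by \<open>y^2\<close>, hence by the potential at \<open>y\<close>. The term \<open>\<epsilon> * x^2\<close> accounts for
the missing powers in the weight.\<close>

lemma real_potential_move_outward_le:
  fixes x y r \<epsilon> :: real
  assumes y: "y \<noteq> 0" and r: "0 < r" "r \<le> 1" and \<epsilon>: "0 \<le> \<epsilon>"
    and d: "\<bar>x - y\<bar> \<le> 2 * r" and out: "0 \<le> y \<Longrightarrow> y \<le> x" "y < 0 \<Longrightarrow> x \<le> y"
  defines "v \<equiv> y^2 / 2 - ln (y^2)"
  shows "x^2 / 2 - ln (x^2) + \<epsilon> * x^2 \<le> v + (r + 2 * \<epsilon>) * (4 * v + 8)"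
proof -
  have lo: "\<bar>y\<bar> \<le> \<bar>x\<bar>" and hi: "\<bar>x\<bar> \<le> \<bar>y\<bar> + 2 * r"
    using d out by (cases "0 \<le> y"; linarith)+
  have "y^2 \<le> x^2" "0 < y^2" using lo y by (simp_all add: abs_le_square_iff)
  then have "ln (y^2) \<le> ln (x^2)" by (subst ln_le_cancel_iff) linarith+
  have x2: "x^2 \<le> y^2 + 4 * r * \<bar>y\<bar> + 4 * r^2"
    using power_mono[OF hi, of 2] by (simp add: power2_sum power_mult_distrib mult_ac)
  have "2 * \<bar>y\<bar> \<le> 1 + y^2"
    using zero_le_power2[of "\<bar>y\<bar> - 1"] by (simp add: power2_diff)
  then have ry: "r * (2 * \<bar>y\<bar>) \<le> r * (1 + y^2)" using r by (intro mult_left_mono) auto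
  have r2: "r^2 \<le> r" using r by (simp add: power2_eq_square mult_left_le)
  have x2': "x^2 \<le> y^2 + 2 * r * (1 + y^2) + 4 * r" using x2 ry r2 by linarith
  have x2'': "x^2 \<le> 2 * y^2 + 8"
  proof -
    have "0 \<le> (\<bar>y\<bar> - 2 * r)^2" by simp
    then have "4 * r * \<bar>y\<bar> \<le> y^2 + 4 * r^2" by (simp add: power2_diff power_mult_distrib mult_ac)
    then show ?thesis using x2 r2 r by linarith
  qed
  have "y^2 / 4 - 1 \<le> v" unfolding v_def by (rule real_potential_ge_quadratic[OF y])
  then have yv: "y^2 \<le> 4 * v + 4" by simp
  have "x^2 / 2 - ln (x^2) \<le> v + r * (y^2 + 3)"
    using x2' \<open>ln (y^2) \<le> ln (x^2)\<close> unfolding v_def by (simp add: algebra_simps)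
  also have "\<dots> \<le> v + r * (4 * v + 8)" using yv r by (intro add_left_mono mult_left_mono) auto
  finally have 1: "x^2 / 2 - ln (x^2) \<le> v + r * (4 * v + 8)" .
  have "\<epsilon> * x^2 \<le> \<epsilon> * (2 * (4 * v + 8))" using x2'' yv \<epsilon> by (intro mult_left_mono) auto
  with 1 show ?thesis by (simp add: algebra_simps)
qed

text \<open>The weight has \<open>N - m\<close> rather than \<open>N\<close> powers of \<open>t^2\<close>. The deficit \<open>m ln (t^2)\<close> is harmful only for
large \<open>t\<close>, and it is at most \<open>m t^2\<close>.\<close>

lemma site_weight_ge:
  fixes t :: real
  assumes t: "t \<noteq> 0" and m: "m \<le> N" "1 \<le> N"
  shows "exp (- real N * (t^2 / 2 - ln (t^2) + real m / real N * t^2)) \<le> t^(2 * (N - m)) * exp (- real N * t^2 / 2)"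
proof -
  have "ln (t^2) \<le> t^2 - 1" using t by (intro ln_le_minus_one) auto
  then have "real m * ln (t^2) \<le> real m * t^2" by (intro mult_left_mono) auto
  then have "- real N * (t^2 / 2 - ln (t^2) + real m / real N * t^2) \<le> real (N - m) * ln (t^2) + (- real N * t^2 / 2)"
    using m by (simp add: of_nat_diff algebra_simps)
  then show ?thesis
    unfolding even_power_eq_exp[OF t] mult_exp_exp by simp
qed

lemma ensemble_weight_ge_on_box:
  assumes r: "0 < r" "r \<le> 1" and m: "1 \<le> m" "m \<le> N" and mono: "mono_on {1..m} y"
    and nz: "\<And>i. i \<in> {1..m} \<Longrightarrow> y i \<noteq> 0"
    and v: "(\<Sum>i=1..m. (y i)^2 / 2 - ln ((y i)^2)) \<le> real m * v"
    and x: "\<And>i. i \<in> {1..m} \<Longrightarrow> x i \<in> box_side m r y i"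
  shows "exp (- (real N * real m) * (v + (r + 2 * (real m / real N)) * (4 * v + 8))) * (r / 2 / exp 1) ^ (2 * m^2)
    \<le> ensemble_weight N m x"
proof -
  define \<epsilon> where "\<epsilon> = real m / real N"
  define w where "w i = (y i)^2 / 2 - ln ((y i)^2)" for i
  have \<epsilon>: "0 \<le> \<epsilon>" by (simp add: \<epsilon>_def)
  note b = box_side_bounds[OF r(1) m(1) _ x]
  have xnz: "x i \<noteq> 0" if "i \<in> {1..m}" for i
    using b[OF that that] nz[OF that] by force
  have site: "(x i)^2 / 2 - ln ((x i)^2) + \<epsilon> * (x i)^2 \<le> w i + (r + 2 * \<epsilon>) * (4 * w i + 8)"
    if "i \<in> {1..m}" for i
    unfolding w_def by (rule real_potential_move_outward_le[OF nz[OF that] r \<epsilon> b[OF that that]])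
  have "(\<Sum>i=1..m. (x i)^2 / 2 - ln ((x i)^2) + \<epsilon> * (x i)^2) \<le> (\<Sum>i=1..m. w i + (r + 2 * \<epsilon>) * (4 * w i + 8))"
    by (intro sum_mono site)
  also have "\<dots> = (1 + 4 * (r + 2 * \<epsilon>)) * (\<Sum>i=1..m. w i) + real m * (8 * (r + 2 * \<epsilon>))"
    by (simp add: sum.distrib sum_distrib_left algebra_simps)
  also have "\<dots> \<le> (1 + 4 * (r + 2 * \<epsilon>)) * (real m * v) + real m * (8 * (r + 2 * \<epsilon>))"
    using v r \<epsilon> unfolding w_def by (intro add_right_mono mult_left_mono) auto
  also have "\<dots> = real m * (v + (r + 2 * \<epsilon>) * (4 * v + 8))" by (simp add: algebra_simps)
  finally have S: "(\<Sum>i=1..m. (x i)^2 / 2 - ln ((x i)^2) + \<epsilon> * (x i)^2) \<le> real m * (v + (r + 2 * \<epsilon>) * (4 * v + 8))" .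
  then have "real N * (\<Sum>i=1..m. (x i)^2 / 2 - ln ((x i)^2) + \<epsilon> * (x i)^2) \<le> real N * (real m * (v + (r + 2 * \<epsilon>) * (4 * v + 8)))"
    by (intro mult_left_mono) auto
  then have "exp (- (real N * real m) * (v + (r + 2 * \<epsilon>) * (4 * v + 8)))
    \<le> exp (\<Sum>i=1..m. - real N * ((x i)^2 / 2 - ln ((x i)^2) + \<epsilon> * (x i)^2))"
    unfolding sum_distrib_left[symmetric] by (simp add: mult.assoc)
  also have "\<dots> = (\<Prod>i=1..m. exp (- real N * ((x i)^2 / 2 - ln ((x i)^2) + \<epsilon> * (x i)^2)))"
    by (rule exp_sum) simp
  also have "\<dots> \<le> (\<Prod>i=1..m. (x i)^(2 * (N - m)) * exp (- real N * (x i)^2 / 2))"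
    unfolding \<epsilon>_def using m xnz by (intro prod_mono conjI site_weight_ge) auto
  finally have 1: "exp (- (real N * real m) * (v + (r + 2 * \<epsilon>) * (4 * v + 8)))
    \<le> (\<Prod>i=1..m. (x i)^(2 * (N - m)) * exp (- real N * (x i)^2 / 2))" .
  have 2: "(r / 2 / exp 1) ^ (2 * m^2) \<le> (\<Prod>i=1..m. \<Prod>j=i+1..m. \<bar>x i - x j\<bar> ^ 2)"
  proof (rule vandermonde_sq_ge)
    fix i j assume "i \<in> {1..m}" "j \<in> {1..m}" "i < j"
    then show "r / 2 * real (j - i) / real m \<le> \<bar>x i - x j\<bar>"
      by (intro box_side_separated[OF r(1) m(1) mono] x)
  qed (use r m in auto)
  have "exp (- (real N * real m) * (v + (r + 2 * \<epsilon>) * (4 * v + 8))) * (r / 2 / exp 1) ^ (2 * m^2)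
    \<le> (\<Prod>i=1..m. (x i)^(2 * (N - m)) * exp (- real N * (x i)^2 / 2)) * (\<Prod>i=1..m. \<Prod>j=i+1..m. \<bar>x i - x j\<bar> ^ 2)"
    using r by (intro mult_mono[OF 1 2] prod_nonneg) auto
  also have "\<dots> = ensemble_weight N m x"
    by (simp only: ensemble_weight_def prod.distrib mult_ac)
  finally show ?thesis unfolding \<epsilon>_def .
qed

text \<open>The weight is bounded below on a whole box around a sorted configuration \<open>y\<close>, and the last factor is
the volume of that box.\<close>

lemma mass_ge:
  assumes r: "0 < r" "r \<le> 1" and m: "1 \<le> m" "m \<le> N" and mono: "mono_on {1..m} y"
    and nz: "\<And>i. i \<in> {1..m} \<Longrightarrow> y i \<noteq> 0"
    and v: "(\<Sum>i=1..m. (y i)^2 / 2 - ln ((y i)^2)) \<le> real m * v"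
    and U: "\<And>x. (\<And>i. i \<in> {1..m} \<Longrightarrow> \<bar>x i - y i\<bar> \<le> 2 * r) \<Longrightarrow> empirical_measure m x \<in> U"
  shows "ennreal (exp (- (real N * real m) * (v + (r + 2 * (real m / real N)) * (4 * v + 8)))
      * (r / 2 / exp 1) ^ (2 * m^2) * (r / (2 * real m)) ^ m) \<le> mass N m U"
proof -
  define K where "K = exp (- (real N * real m) * (v + (r + 2 * (real m / real N)) * (4 * v + 8))) * (r / 2 / exp 1) ^ (2 * m^2)"
  have K: "0 \<le> K" using r by (simp add: K_def)
  let ?B = "\<Pi>\<^sub>E i\<in>{1..m}. box_side m r y i"
  have "emeasure (\<Pi>\<^sub>M i\<in>{1..m}. lborel) ?B = (\<Prod>i=1..m. emeasure lborel (box_side m r y i))"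
    by (rule lborel_prod.emeasure_PiM) (auto simp: box_side_def)
  also have "\<dots> = ennreal ((r / (2 * real m)) ^ m)"
    using r by (simp add: box_side_def ennreal_power)
  finally have vol: "emeasure (\<Pi>\<^sub>M i\<in>{1..m}. lborel) ?B = ennreal ((r / (2 * real m)) ^ m)" .
  have "ennreal (K * (r / (2 * real m)) ^ m) = ennreal K * emeasure (\<Pi>\<^sub>M i\<in>{1..m}. lborel) ?B"
    unfolding vol using K r by (intro ennreal_mult) auto
  also have "\<dots> = (\<integral>\<^sup>+ x. ennreal K * indicator ?B x \<partial>(\<Pi>\<^sub>M i\<in>{1..m}. lborel))"
    by (rule nn_integral_cmult_indicator[symmetric]) (auto intro!: sets_PiM_I_finite simp: box_side_def)
  also have "\<dots> \<le> mass N m U"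
    unfolding mass_def
  proof (rule nn_integral_mono)
    fix x
    show "ennreal K * indicator ?B x \<le> ennreal (ensemble_weight N m x) * indicator U (empirical_measure m x)"
    proof (cases "x \<in> ?B")
      case True
      then have x: "x i \<in> box_side m r y i" if "i \<in> {1..m}" for i using that by (rule PiE_mem)
      have "K \<le> ensemble_weight N m x"
        unfolding K_def by (rule ensemble_weight_ge_on_box[OF r m mono nz v x])
      moreover have "empirical_measure m x \<in> U"
        by (rule U) (rule box_side_bounds(1)[OF r(1) m(1) _ x])
      ultimately show ?thesis using True by (simp add: ennreal_leI)
    qed simp
  qed
  finally show ?thesis unfolding K_def .
qed

section \<open>Quantile points\<close>

lemma cdf_empirical_measure:
  assumes "1 \<le> m"
  shows "cdf (empirical_measure m x) t = real (card {i \<in> {1..m}. x i \<le> t}) / real m"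
proof -
  have "emeasure (empirical_measure m x) {..t} = ennreal (1 / real m) * of_nat (card {i \<in> {1..m}. x i \<le> t})"
    by (subst emeasure_empirical_measure) (auto simp: indicator_def sum.If_cases Int_def)
  also have "\<dots> = ennreal (real (card {i \<in> {1..m}. x i \<le> t}) / real m)"
    by (simp add: ennreal_of_nat_eq_real_of_nat ennreal_mult[symmetric])
  finally show ?thesis by (simp add: cdf_def measure_def)
qed

text \<open>With one point in each block of length \<open>1/m\<close>, only the block that contains \<open>F\<close> is undecided.\<close>

lemma stratified_count:
  fixes u :: "nat \<Rightarrow> real"
  assumes m: "1 \<le> m" and F: "0 \<le> F" "F \<le> 1"
    and u: "\<And>i. i \<in> {1..m} \<Longrightarrow> (real i - 1) / real m < u i \<and> u i < real i / real m"
  shows "\<bar>real (card {i \<in> {1..m}. u i \<le> F}) / real m - F\<bar> \<le> 1 / real m"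
proof -
  \<comment> \<open>the first \<open>k\<close> blocks lie below \<open>F\<close>, and all blocks after the next one lie above\<close>
  define k where "k = nat \<lfloor>real m * F\<rfloor>"
  have nn: "0 \<le> real m * F" using F by simp
  have k: "real k \<le> real m * F" "real m * F < real k + 1"
    using nn by (auto simp: k_def of_nat_nat)
  have "real m * F \<le> real m * 1" using F by (intro mult_left_mono) auto
  then have km: "k \<le> m" using k by linarith
  have "{1..k} \<subseteq> {i \<in> {1..m}. u i \<le> F}"
  proof
    fix i assume i: "i \<in> {1..k}"
    then have "u i < real i / real m" using u[of i] km by auto
    also have "\<dots> \<le> F" using i k m by (simp add: divide_le_eq mult.commute)
    finally show "i \<in> {i \<in> {1..m}. u i \<le> F}" using i km by auto
  qed
  then have "card {1..k} \<le> card {i \<in> {1..m}. u i \<le> F}" by (intro card_mono) auto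
  then have 1: "real k \<le> real (card {i \<in> {1..m}. u i \<le> F})" by simp
  have "{i \<in> {1..m}. u i \<le> F} \<subseteq> {1..k+1}"
  proof
    fix i assume i: "i \<in> {i \<in> {1..m}. u i \<le> F}"
    then have "(real i - 1) / real m < F" using u[of i] by auto
    then have "real i - 1 < real m * F" using m by (simp add: divide_less_eq mult.commute)
    then show "i \<in> {1..k+1}" using i k by auto
  qed
  then have "card {i \<in> {1..m}. u i \<le> F} \<le> card {1..k+1}" by (intro card_mono) auto
  then have 2: "real (card {i \<in> {1..m}. u i \<le> F}) \<le> real k + 1" by simp
  have "\<bar>real (card {i \<in> {1..m}. u i \<le> F}) - real m * F\<bar> \<le> 1"
    using 1 2 k by linarith
  then have "\<bar>(real (card {i \<in> {1..m}. u i \<le> F}) - real m * F) / real m\<bar> \<le> 1 / real m"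
    using m by (simp add: abs_divide divide_right_mono)
  then show ?thesis using m by (simp add: diff_divide_distrib)
qed

text \<open>If the function exceeded its average by the slack \<open>\<eta>\<close> everywhere, so would its integral. The slack
allows the integrals to be compared by weak inequalities.\<close>

lemma exists_le_average:
  fixes f :: "real \<Rightarrow> ennreal"
  assumes ab: "a < b" and \<eta>: "0 < \<eta>"
    and fin: "(\<integral>\<^sup>+u. f u * indicator {a<..<b} u \<partial>lborel) < \<infinity>"
  shows "\<exists>u\<in>{a<..<b}. ennreal (b - a) * f u \<le> (\<integral>\<^sup>+u. f u * indicator {a<..<b} u \<partial>lborel) + ennreal (\<eta> * (b - a))"
proof (rule ccontr)
  define J where "J = (\<integral>\<^sup>+u. f u * indicator {a<..<b} u \<partial>lborel)"
  assume "\<not> ?thesis"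
  then have gt: "J + ennreal (\<eta> * (b - a)) < ennreal (b - a) * f u" if "u \<in> {a<..<b}" for u
    using that unfolding J_def by (meson not_le)
  define c where "c = ennreal (1 / (b - a)) * (J + ennreal (\<eta> * (b - a)))"
  have one: "ennreal (1 / (b - a)) * ennreal (b - a) = 1"
    using ab by (simp add: ennreal_mult[symmetric])
  have "c \<le> f u" if "u \<in> {a<..<b}" for u
  proof -
    have "c \<le> ennreal (1 / (b - a)) * (ennreal (b - a) * f u)"
      unfolding c_def using gt[OF that] by (intro mult_left_mono) auto
    then show ?thesis by (simp only: mult.assoc[symmetric] one mult_1)
  qed
  then have "(\<integral>\<^sup>+u. c * indicator {a<..<b} u \<partial>lborel) \<le> J"
    unfolding J_def by (intro nn_integral_mono) (auto split: split_indicator)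
  moreover have "(\<integral>\<^sup>+u. c * indicator {a<..<b} u \<partial>lborel) = c * ennreal (b - a)"
    using ab by (subst nn_integral_cmult_indicator) auto
  moreover have "c * ennreal (b - a) = J + ennreal (\<eta> * (b - a))"
  proof -
    have "c * ennreal (b - a) = ennreal (1 / (b - a)) * ennreal (b - a) * (J + ennreal (\<eta> * (b - a)))"
      unfolding c_def by (simp only: mult_ac)
    then show ?thesis by (simp only: one mult_1)
  qed
  ultimately have "J + ennreal (\<eta> * (b - a)) \<le> J" by simp
  moreover have "J \<noteq> \<infinity>" using fin unfolding J_def by simp
  ultimately have "ennreal (\<eta> * (b - a)) \<le> 0"
    by (metis add.right_neutral ennreal_add_left_cancel_le infinity_ennreal_def)
  then show False using ab \<eta> by (simp add: mult_le_0_iff)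
qed

text \<open>The quantile function carries Lebesgue measure on \<open>(0,1)\<close> to \<open>\<mu>\<close>. From each block
\<open>((i-1)/m, i/m)\<close> a level is chosen at which the potential of the quantile is at most its block average,
up to a slack. These block averages add up to the energy of \<open>\<mu>\<close>. Monotonicity of the
quantile function sorts the points, and one level per block keeps the distribution function within
\<open>1/m\<close> of that of \<open>\<mu>\<close>.\<close>

lemma exists_quantile_points:
  assumes \<mu>: "\<mu> \<in> real_prob_measures" and v: "energy \<mu> < ennreal v" and m: "1 \<le> m"
  shows "\<exists>y. mono_on {1..m} y \<and> (\<forall>i\<in>{1..m}. y i \<noteq> 0) \<and>
     (\<Sum>i=1..m. (y i)^2 / 2 - ln ((y i)^2)) \<le> real m * v \<and>
     (\<forall>t. \<bar>cdf (empirical_measure m y) t - cdf \<mu> t\<bar> \<le> 1 / real m)"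
proof -
  interpret cdf_distribution \<mu>
    using \<mu> by (simp add: real_prob_measures_iff cdf_distribution_def)
  define Q where "Q = I"
  have Q_meas [measurable]: "Q \<in> borel_measurable (restrict_space borel {0<..<1})"
    unfolding Q_def by (rule measurable_CI)
  have Q_le: "Q u \<le> t \<longleftrightarrow> u \<le> cdf \<mu> t" if "u \<in> {0<..<1}" for u t
    unfolding Q_def using pseudoinverse[of u t] that by auto
  have Q_mono: "mono_on {0<..<1} Q" unfolding Q_def by (rule mono_I)
  obtain e where e: "energy \<mu> = ennreal e" "0 \<le> e" "e < v"
    using v by (cases "energy \<mu>") (auto simp: ennreal_less_iff)
  define \<eta> where "\<eta> = v - e"
  have \<eta>: "0 < \<eta>" using e by (simp add: \<eta>_def)
  define f where "f u = potential (Q u)" for u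
  have f [measurable]: "f \<in> borel_measurable (restrict_space borel {0<..<1})"
    unfolding f_def by measurable
  have "energy \<mu> = (\<integral>\<^sup>+u. f u \<partial>restrict_space lborel {0<..<1})"
    unfolding energy_def f_def Q_def
    by (subst distr_I_eq_M[symmetric]) (rule nn_integral_distr; simp)
  also have "\<dots> = (\<integral>\<^sup>+u. f u * indicator {0<..<1} u \<partial>lborel)"
    by (rule nn_integral_restrict_space) simp
  finally have E: "(\<integral>\<^sup>+u. f u * indicator {0<..<1} u \<partial>lborel) = ennreal e" using e by simp
  define B where "B i = {(real i - 1) / real m <..< real i / real m}" for i :: nat
  define J where "J i = (\<integral>\<^sup>+u. f u * indicator (B i) u \<partial>lborel)" for i
  have B_sub: "B i \<subseteq> {0<..<1}" if "i \<in> {1..m}" for i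
  proof
    fix u assume u: "u \<in> B i"
    have "0 \<le> (real i - 1) / real m" "real i / real m \<le> 1" using that by auto
    then show "u \<in> {0<..<1}" using u unfolding B_def greaterThanLessThan_iff by linarith
  qed
  have B_disj: "disjoint_family_on B {1..m}"
    unfolding disjoint_family_on_def
  proof (intro ballI impI)
    fix i j assume ij: "i \<in> {1..m}" "j \<in> {1..m}" "i \<noteq> j"
    have "B i \<inter> B j = {}" if "i < j" for i j
    proof -
      have "real i / real m \<le> (real j - 1) / real m" using that by (intro divide_right_mono) auto
      then show ?thesis unfolding B_def by auto
    qed
    from this[of i j] this[of j i] show "B i \<inter> B j = {}" using ij by (cases "i < j") auto
  qed
  have fm: "(\<lambda>u. f u * indicator (B i) u) \<in> borel_measurable lborel" if "i \<in> {1..m}" for i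
  proof -
    have "f \<in> borel_measurable (restrict_space borel (B i))"
      by (rule measurable_restrict_mono[OF f B_sub[OF that]])
    then have "(\<lambda>u. f u * indicator (B i) u) \<in> borel_measurable borel"
      by (subst (asm) borel_measurable_restrict_space_iff_ennreal) (auto simp: B_def)
    then show ?thesis by simp
  qed
  have "(\<Sum>i=1..m. J i) = (\<integral>\<^sup>+u. (\<Sum>i=1..m. f u * indicator (B i) u) \<partial>lborel)"
    unfolding J_def by (rule nn_integral_sum[symmetric]) (rule fm)
  also have "\<dots> \<le> (\<integral>\<^sup>+u. f u * indicator {0<..<1} u \<partial>lborel)"
  proof (rule nn_integral_mono)
    fix u
    have "(\<Sum>i=1..m. f u * indicator (B i) u) = f u * indicator (\<Union>i\<in>{1..m}. B i) u"
      using B_disj by (simp add: sum_distrib_left[symmetric] indicator_UN_disjoint)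
    also have "\<dots> \<le> f u * indicator {0<..<1} u"
    proof (rule mult_left_mono)
      have "(\<Union>i\<in>{1..m}. B i) \<subseteq> {0<..<1}" using B_sub by (rule UN_least)
      then show "indicator (\<Union>i\<in>{1..m}. B i) u \<le> (indicator {0<..<1} u :: ennreal)"
        by (cases "u \<in> (\<Union>i\<in>{1..m}. B i)") (simp_all add: indicator_def subset_eq, blast)
    qed simp
    finally show "(\<Sum>i=1..m. f u * indicator (B i) u) \<le> f u * indicator {0<..<1} u" .
  qed
  finally have J_sum: "(\<Sum>i=1..m. J i) \<le> ennreal e" using E by simp
  have J_fin: "J i < \<infinity>" if "i \<in> {1..m}" for i
  proof -
    have "J i \<le> (\<Sum>i=1..m. J i)" using that by (intro member_le_sum) auto
    also note J_sum
    also have "ennreal e < \<infinity>" by simp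
    finally show ?thesis .
  qed
  have "\<exists>u\<in>B i. ennreal (1 / real m) * f u \<le> J i + ennreal (\<eta> * (1 / real m))" if i: "i \<in> {1..m}" for i
  proof -
    have len: "real i / real m - (real i - 1) / real m = 1 / real m"
      by (simp add: diff_divide_distrib)
    have "(real i - 1) / real m < real i / real m" using m by (intro divide_strict_right_mono) auto
    then show ?thesis
      using exists_le_average[of "(real i - 1) / real m" "real i / real m" \<eta> f] \<eta> J_fin[OF i]
      unfolding len J_def B_def by blast
  qed
  then obtain u where u: "\<And>i. i \<in> {1..m} \<Longrightarrow> u i \<in> B i"
    and uJ: "\<And>i. i \<in> {1..m} \<Longrightarrow> ennreal (1 / real m) * f (u i) \<le> J i + ennreal (\<eta> * (1 / real m))"
    by metis
  define y where "y i = Q (u i)" for i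
  have "(\<Sum>i=1..m. ennreal (1 / real m) * f (u i)) \<le> (\<Sum>i=1..m. J i + ennreal (\<eta> * (1 / real m)))"
    by (intro sum_mono uJ)
  also have "\<dots> = (\<Sum>i=1..m. J i) + of_nat m * ennreal (\<eta> * (1 / real m))"
    by (simp add: sum.distrib)
  also have "of_nat m * ennreal (\<eta> * (1 / real m)) = ennreal \<eta>"
    using m \<eta> by (simp add: ennreal_of_nat_eq_real_of_nat ennreal_mult[symmetric])
  also have "(\<Sum>i=1..m. J i) + ennreal \<eta> \<le> ennreal e + ennreal \<eta>"
    by (intro add_right_mono J_sum)
  also have "\<dots> = ennreal v" using e \<eta> by (simp add: ennreal_plus[symmetric] \<eta>_def del: ennreal_plus)
  finally have en: "energy (empirical_measure m y) \<le> ennreal v"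
    unfolding energy_def nn_integral_empirical_measure[OF m measurable_potential]
    by (simp add: sum_distrib_left f_def y_def)
  have nz: "y i \<noteq> 0" if i: "i \<in> {1..m}" for i
  proof
    assume "y i = 0"
    then have "f (u i) = \<infinity>" by (simp add: f_def y_def)
    then have "\<infinity> \<le> J i + ennreal (\<eta> * (1 / real m))" using uJ[OF i] m by (simp add: ennreal_mult_top)
    then show False using J_fin[OF i] by (simp add: top_unique)
  qed
  show ?thesis
  proof (intro exI[of _ y] conjI allI ballI nz)
    show "mono_on {1..m} y"
    proof (rule mono_onI)
      fix i j assume ij: "i \<in> {1..m}" "j \<in> {1..m}" "i \<le> j"
      show "y i \<le> y j"
      proof (cases "i = j")
        case False
        then have "real i / real m \<le> (real j - 1) / real m" using ij by (intro divide_right_mono) auto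
        then have "u i \<le> u j" using u[OF ij(1)] u[OF ij(2)] unfolding B_def greaterThanLessThan_iff by linarith
        then show ?thesis
          unfolding y_def using u B_sub ij by (intro mono_onD[OF Q_mono]) blast+
      qed simp
    qed
    show "(\<Sum>i=1..m. (y i)^2 / 2 - ln ((y i)^2)) \<le> real m * v"
    proof -
      have nn: "0 \<le> (y i)^2 / 2 - ln ((y i)^2)" if "i \<in> {1..m}" for i
        using real_potential_ge_min[OF nz[OF that]] min_potential_pos by linarith
      have "ennreal ((\<Sum>i=1..m. (y i)^2 / 2 - ln ((y i)^2)) / real m) \<le> ennreal v"
        using en energy_empirical_measure_nonzero[of m y, OF m nz] by simp
      then have "(\<Sum>i=1..m. (y i)^2 / 2 - ln ((y i)^2)) / real m \<le> v"
        using e by (simp only: ennreal_le_iff)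
      then show ?thesis using m by (simp add: pos_divide_le_eq mult.commute)
    qed
    fix t
    have "cdf (empirical_measure m y) t = real (card {i \<in> {1..m}. u i \<le> cdf \<mu> t}) / real m"
    proof -
      have "y i \<le> t \<longleftrightarrow> u i \<le> cdf \<mu> t" if "i \<in> {1..m}" for i
        unfolding y_def using B_sub[OF that] u[OF that] by (intro Q_le) blast
      then have "{i \<in> {1..m}. y i \<le> t} = {i \<in> {1..m}. u i \<le> cdf \<mu> t}" by blast
      then show ?thesis by (simp only: cdf_empirical_measure[OF m])
    qed
    then show "\<bar>cdf (empirical_measure m y) t - cdf \<mu> t\<bar> \<le> 1 / real m"
      using stratified_count[OF m cdf_nonneg cdf_bounded_prob, of u t] u
      unfolding B_def greaterThanLessThan_iff by simp
  qed
qed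

lemma eventually_quantile_points:
  assumes \<mu>: "\<mu> \<in> real_prob_measures" and v: "energy \<mu> < ennreal v" and \<rho>: "0 < \<rho>"
  shows "\<exists>m0. \<forall>m\<ge>m0. 1 \<le> m \<longrightarrow> (\<exists>y. mono_on {1..m} y \<and> (\<forall>i\<in>{1..m}. y i \<noteq> 0) \<and>
     (\<Sum>i=1..m. (y i)^2 / 2 - ln ((y i)^2)) \<le> real m * v \<and> dBL (empirical_measure m y) \<mu> < \<rho>)"
proof -
  have "\<forall>n. \<exists>y. mono_on {1..Suc n} y \<and> (\<forall>i\<in>{1..Suc n}. y i \<noteq> 0) \<and>
     (\<Sum>i=1..Suc n. (y i)^2 / 2 - ln ((y i)^2)) \<le> real (Suc n) * v \<and>
     (\<forall>t. \<bar>cdf (empirical_measure (Suc n) y) t - cdf \<mu> t\<bar> \<le> 1 / real (Suc n))"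
    by (intro allI exists_quantile_points[OF \<mu> v]) simp
  from choice[OF this] obtain Y where Y: "\<forall>n. mono_on {1..Suc n} (Y n) \<and> (\<forall>i\<in>{1..Suc n}. Y n i \<noteq> 0) \<and>
     (\<Sum>i=1..Suc n. (Y n i)^2 / 2 - ln ((Y n i)^2)) \<le> real (Suc n) * v \<and>
     (\<forall>t. \<bar>cdf (empirical_measure (Suc n) (Y n)) t - cdf \<mu> t\<bar> \<le> 1 / real (Suc n))"
    by (rule exE)
  have "(\<lambda>n. cdf (empirical_measure (Suc n) (Y n)) t) \<longlonglongrightarrow> cdf \<mu> t" for t
  proof (rule LIM_zero_cancel, rule Lim_null_comparison)
    show "\<forall>\<^sub>F n in sequentially. norm (cdf (empirical_measure (Suc n) (Y n)) t - cdf \<mu> t) \<le> 1 / real (Suc n)"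
      using Y by (intro always_eventually allI) (simp only: real_norm_def)
    show "(\<lambda>n. 1 / real (Suc n)) \<longlonglongrightarrow> 0"
      using LIMSEQ_inverse_real_of_nat by (simp add: inverse_eq_divide)
  qed
  then have "weak_conv_m (\<lambda>n. empirical_measure (Suc n) (Y n)) \<mu>"
    by (simp add: weak_conv_m_def weak_conv_def)
  then have "(\<lambda>n. dBL (empirical_measure (Suc n) (Y n)) \<mu>) \<longlonglongrightarrow> 0"
    using \<mu> by (intro weak_conv_imp_dBL_tendsto empirical_measure_in_real_prob_measures) simp_all
  from order_tendstoD(2)[OF this \<rho>]
  obtain n0 where n0: "\<forall>n\<ge>n0. dBL (empirical_measure (Suc n) (Y n)) \<mu> < \<rho>"
    unfolding eventually_sequentially by blast
  show ?thesis
  proof (intro exI[of _ "Suc n0"] allI impI)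
    fix m :: nat assume "Suc n0 \<le> m" "1 \<le> m"
    then obtain n where n: "m = Suc n" "n0 \<le> n" by (cases m) auto
    show "\<exists>y. mono_on {1..m} y \<and> (\<forall>i\<in>{1..m}. y i \<noteq> 0) \<and>
      (\<Sum>i=1..m. (y i)^2 / 2 - ln ((y i)^2)) \<le> real m * v \<and> dBL (empirical_measure m y) \<mu> < \<rho>"
      unfolding n(1) using spec[OF Y, of n] n0[rule_format, OF n(2)] by (intro exI[of _ "Y n"] conjI) simp_all
  qed
qed

section \<open>The large deviation principle\<close>

lemma measurable_ensemble_weight [measurable]:
  "ensemble_weight N m \<in> borel_measurable (\<Pi>\<^sub>M i\<in>{1..m}. lborel)"
  unfolding ensemble_weight_def[abs_def] by measurable

text \<open>The lower bound applies to any configuration; all \<open>y i = 1\<close> will do, with mean potential \<open>1/2\<close>.\<close>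

lemma mass_pos:
  assumes m: "1 \<le> m" "m \<le> N"
  shows "0 < mass N m UNIV"
proof -
  have "0 < ennreal (exp (- (real N * real m) * (1/2 + (1 + 2 * (real m / real N)) * (4 * (1/2) + 8)))
      * (1 / 2 / exp 1) ^ (2 * m^2) * (1 / (2 * real m)) ^ m)"
    using m by simp
  also have "\<dots> \<le> mass N m UNIV"
    by (rule mass_ge[of 1 m N "\<lambda>_. 1"]) (use m in \<open>auto simp: mono_on_def\<close>)
  finally show ?thesis .
qed

lemma mass_topspace: 
  assumes "1 \<le> m"
  shows "mass N m real_prob_measures = mass N m UNIV"
  unfolding mass_def using empirical_measure_in_real_prob_measures[OF assms]
  by (intro nn_integral_cong) (simp add: indicator_def)

lemma emeasure_empirical_law:
  assumes m: "1 \<le> m" and U: "U \<in> sets (borel_of prob_topology)"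
  shows "emeasure (empirical_law N m) U = mass N m U / mass N m UNIV"
proof -
  let ?R = "\<Pi>\<^sub>M i\<in>{1..m}. (lborel :: real measure)"
  have E: "ensemble N m = density ?R (\<lambda>x. ennreal (ensemble_weight N m x) / mass N m UNIV)"
    by (simp add: ensemble_def mass_def Let_def)
  have S: "empirical_measure m -` U \<inter> space ?R \<in> sets ?R"
    using U by (rule measurable_sets[OF measurable_empirical_measure[OF m]])
  have D: "(\<lambda>x. ennreal (ensemble_weight N m x) / mass N m UNIV) \<in> borel_measurable ?R"
    unfolding divide_ennreal_def
    by (intro borel_measurable_times_ennreal borel_measurable_const
        measurable_compose[OF measurable_ensemble_weight measurable_ennreal])
  have W: "(\<lambda>x. ennreal (ensemble_weight N m x) * indicator U (empirical_measure m x)) \<in> borel_measurable ?R"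
    by (intro borel_measurable_times_ennreal measurable_compose[OF measurable_ensemble_weight measurable_ennreal]
        measurable_compose[OF measurable_empirical_measure[OF m] borel_measurable_indicator[OF U]])
  have "empirical_measure m \<in> measurable (ensemble N m) (borel_of prob_topology)"
    unfolding E using measurable_empirical_measure[OF m] by (simp only: measurable_density_eq1)
  then have "emeasure (empirical_law N m) U = emeasure (ensemble N m) (empirical_measure m -` U \<inter> space (ensemble N m))"
    unfolding empirical_law_def using U by (rule emeasure_distr)
  also have "\<dots> = emeasure (ensemble N m) (empirical_measure m -` U \<inter> space ?R)"
    by (simp add: E)
  also have "\<dots> = (\<integral>\<^sup>+x. ennreal (ensemble_weight N m x) / mass N m UNIV * indicator (empirical_measure m -` U \<inter> space ?R) x \<partial>?R)"
    unfolding E by (rule emeasure_density[OF D S])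
  also have "\<dots> = (\<integral>\<^sup>+x. ennreal (ensemble_weight N m x) * indicator U (empirical_measure m x) / mass N m UNIV \<partial>?R)"
    by (intro nn_integral_cong) (auto simp: indicator_def)
  also have "\<dots> = mass N m U / mass N m UNIV"
    unfolding mass_def by (rule nn_integral_divide[OF W])
  finally show ?thesis .
qed

lemma sets_empirical_law: "sets (empirical_law N m) = sets (borel_of prob_topology)"
  by (simp add: empirical_law_def)

lemma prob_space_empirical_law:
  assumes m: "1 \<le> m" "m \<le> N"
  shows "prob_space (empirical_law N m)"
proof (rule prob_spaceI)
  have "space (empirical_law N m) = real_prob_measures"
    by (simp add: empirical_law_def space_borel_of)
  moreover have "real_prob_measures \<in> sets (borel_of prob_topology)"
    using openin_topspace[of prob_topology] by (intro openin_sets_borel_of) simp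
  ultimately show "emeasure (empirical_law N m) (space (empirical_law N m)) = 1"
    using mass_pos[OF m] mass_finite[OF m, of UNIV]
    by (simp add: emeasure_empirical_law[OF m(1)] mass_topspace[OF m(1)] ennreal_divide_self)
qed

lemma measure_empirical_law:
  assumes m: "1 \<le> m" "m \<le> N" and U: "U \<in> sets (borel_of prob_topology)"
  shows "measure (empirical_law N m) U = enn2real (mass N m U) / enn2real (mass N m UNIV)"
proof -
  obtain p where p: "mass N m U = ennreal p" "0 \<le> p"
    using mass_finite[OF m, of U] by (cases "mass N m U") auto
  obtain z where z: "mass N m UNIV = ennreal z" "0 \<le> z"
    using mass_finite[OF m, of UNIV] by (cases "mass N m UNIV") auto
  have "0 < z" using mass_pos[OF m] z by simp
  then show ?thesis
    unfolding measure_def emeasure_empirical_law[OF m(1) U] using p z by (simp add: divide_ennreal)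
qed

lemma scaled_elog_ge:
  assumes "0 < a" "exp (- a * s) \<le> p"
  shows "ereal (- s) \<le> ereal (1 / a) * elog p"
proof -
  have p: "0 < p" using assms(2) exp_gt_zero[of "- a * s"] by linarith
  have "- a * s \<le> ln p" using assms(2) p by (simp add: ln_ge_iff)
  then have "- s \<le> 1 / a * ln p" using assms(1) by (simp add: field_simps)
  then show ?thesis using p by (simp add: elog_def)
qed

lemma scaled_elog_le:
  assumes "0 < a" "0 \<le> p" "p \<le> exp (- a * s)"
  shows "ereal (1 / a) * elog p \<le> ereal (- s)"
proof (cases "p = 0")
  case False
  then have "ln p \<le> ln (exp (- a * s))" using assms by (subst ln_le_cancel_iff) auto
  then have "1 / a * ln p \<le> - s" using assms(1) by (simp add: field_simps)
  then show ?thesis using False by (simp add: elog_def)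
qed (use assms in \<open>simp add: elog_def\<close>)

text \<open>The regime of the theorem: the number of points tends to infinity, but more slowly than \<open>N\<close>.\<close>

locale sublinear_size =
  fixes M :: "nat \<Rightarrow> nat"
  assumes range_M: "1 \<le> N \<Longrightarrow> 1 \<le> M N \<and> M N \<le> N"
    and M_at_top: "filterlim M at_top sequentially"
    and M_over_N: "(\<lambda>N. real (M N) / real N) \<longlonglongrightarrow> 0"
begin

lemma eventually_ratio_small: "0 < \<epsilon> \<Longrightarrow> \<forall>\<^sub>F N in sequentially. real (M N) / real N < \<epsilon>"
  using order_tendstoD(2)[OF M_over_N] .

lemma eventually_ratio_mult_small:
  assumes "0 < \<epsilon>"
  shows "\<forall>\<^sub>F N in sequentially. real (M N) / real N * K < \<epsilon>"
  by (rule order_tendstoD(2)[OF tendsto_mult_left_zero[OF M_over_N] assms])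

lemma eventually_mass_le:
  assumes c: "0 \<le> c" "\<And>\<mu>. \<mu> \<in> U \<Longrightarrow> ennreal c \<le> energy \<mu>" and \<eta>: "0 < \<eta>"
  shows "\<forall>\<^sub>F N in sequentially. mass N (M N) U \<le> ennreal (exp (- (real N * real (M N)) * (c - \<eta>)))"
proof -
  \<comment> \<open>small enough for \<open>(1 - \<delta>) c - \<delta> \<ge> c - \<eta>/2\<close>\<close>
  define \<delta> where "\<delta> = min 1 (\<eta> / (2 * (c + 1)))"
  have \<delta>: "0 < \<delta>" "\<delta> \<le> 1" using c \<eta> by (auto simp: \<delta>_def)
  have "\<delta> \<le> \<eta> / (2 * (c + 1))" by (simp add: \<delta>_def)
  then have \<delta>c: "\<delta> * (c + 1) \<le> \<eta> / 2" using c by (simp add: field_simps)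
  define K where "K = sqrt (4 * pi / \<delta>)"
  have K: "0 < K" using \<delta> by (simp add: K_def)
  have ev: "\<forall>\<^sub>F N in sequentially. ln K < real N * (\<eta> / 2)"
    using \<eta> by real_asymp
  show ?thesis
    using ev eventually_ratio_small[OF \<delta>(1)] eventually_ratio_small[OF zero_less_one] eventually_ge_at_top[of "1::nat"]
  proof eventually_elim
    case (elim N)
    have m: "1 \<le> M N" using range_M[OF elim(4)] by simp
    have mN: "M N < N" using elim(3,4) by (simp add: divide_less_eq)
    have m\<delta>: "real (M N) \<le> \<delta> * real N" using elim(2,4) by (simp add: divide_less_eq)
    have "K ^ M N = exp (real (M N) * ln K)" using K by (simp add: exp_of_nat_mult)
    also have "\<dots> \<le> exp (real (M N) * (real N * (\<eta> / 2)))"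
      unfolding exp_le_cancel_iff using elim(1) by (intro mult_left_mono) auto
    finally have KM: "K ^ M N \<le> exp (real (M N) * (real N * (\<eta> / 2)))" .
    have "c - \<eta> / 2 \<le> (1 - \<delta>) * c - \<delta>" using \<delta>c by (simp add: algebra_simps)
    then have "real N * real (M N) * (c - \<eta> / 2) \<le> real N * real (M N) * ((1 - \<delta>) * c - \<delta>)"
      by (intro mult_left_mono) auto
    then have "exp (- (real N * real (M N)) * ((1 - \<delta>) * c - \<delta>)) * K ^ M N
      \<le> exp (- (real N * real (M N)) * (c - \<eta> / 2)) * exp (real (M N) * (real N * (\<eta> / 2)))"
      using KM K by (intro mult_mono) auto
    also have "\<dots> = exp (- (real N * real (M N)) * (c - \<eta>))"
      unfolding mult_exp_exp by (simp add: algebra_simps)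
    finally have "exp (- (real N * real (M N)) * ((1 - \<delta>) * c - \<delta>)) * K ^ M N
      \<le> exp (- (real N * real (M N)) * (c - \<eta>))" .
    then show ?case
      by (intro order.trans[OF mass_le[OF m mN m\<delta> \<delta> c(2)]] ennreal_leI) (simp_all only: K_def)
  qed
qed

lemma eventually_mass_ge:
  assumes U: "openin prob_topology U" "\<mu> \<in> U" and v: "energy \<mu> < ennreal v" and \<eta>: "0 < \<eta>"
  shows "\<forall>\<^sub>F N in sequentially. ennreal (exp (- (real N * real (M N)) * (v + \<eta>))) \<le> mass N (M N) U"
proof -
  have \<mu>: "\<mu> \<in> real_prob_measures" using openin_subset[OF U(1)] U(2) by auto
  have v0: "0 \<le> v"
  proof (rule ccontr)
    assume "\<not> 0 \<le> v" then have "ennreal v = 0" by (simp add: ennreal_neg)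
    then show False using v by simp
  qed
  obtain \<rho> where \<rho>: "0 < \<rho>" "BL.mball \<mu> \<rho> \<subseteq> U"
    using U unfolding BL.openin_mtopology by blast
  obtain m0 where m0: "\<forall>m\<ge>m0. 1 \<le> m \<longrightarrow> (\<exists>y. mono_on {1..m} y \<and> (\<forall>i\<in>{1..m}. y i \<noteq> 0) \<and>
     (\<Sum>i=1..m. (y i)^2 / 2 - ln ((y i)^2)) \<le> real m * v \<and> dBL (empirical_measure m y) \<mu> < \<rho> / 2)"
    using eventually_quantile_points[OF \<mu> v, of "\<rho> / 2"] \<rho> by auto
  \<comment> \<open>the displacement \<open>2 r\<close> must stay within half of \<open>\<rho>\<close> and cost at most \<open>\<eta>/4\<close> in energy\<close>
  define r where "r = min 1 (min (\<rho> / 4) (\<eta> / 4 / (4 * v + 8)))"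
  have r: "0 < r" "r \<le> 1" "2 * r \<le> \<rho> / 2" using \<rho> \<eta> v0 by (auto simp: r_def)
  have "r \<le> \<eta> / 4 / (4 * v + 8)" by (simp add: r_def)
  then have rv: "r * (4 * v + 8) \<le> \<eta> / 4" using v0 by (subst (asm) pos_le_divide_eq) auto
  define L where "L = - ln (r / 2 / exp 1)"
  have ev_ln: "\<forall>\<^sub>F N in sequentially. ln (2 * real N / r) < real N * (\<eta> / 4)"
    using \<eta> r by real_asymp
  have ev_M: "\<forall>\<^sub>F N in sequentially. m0 \<le> M N"
    using M_at_top by (simp add: filterlim_at_top)
  have \<eta>4: "0 < \<eta> / 4" using \<eta> by simp
  show ?thesis
    using ev_ln ev_M eventually_ratio_mult_small[OF \<eta>4, of "2 * (4 * v + 8)"]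
      eventually_ratio_mult_small[OF \<eta>4, of "2 * L"] eventually_ge_at_top[of "1::nat"]
  proof eventually_elim
    case (elim N)
    have m: "1 \<le> M N" "M N \<le> N" using range_M[OF elim(5)] by auto
    obtain y where y: "mono_on {1..M N} y" "\<forall>i\<in>{1..M N}. y i \<noteq> 0"
      "(\<Sum>i=1..M N. (y i)^2 / 2 - ln ((y i)^2)) \<le> real (M N) * v" "dBL (empirical_measure (M N) y) \<mu> < \<rho> / 2"
      using m0 elim(2) m(1) by blast
    have in_U: "empirical_measure (M N) x \<in> U" if x: "\<And>i. i \<in> {1..M N} \<Longrightarrow> \<bar>x i - y i\<bar> \<le> 2 * r" for x
    proof -
      note P = empirical_measure_in_real_prob_measures[OF m(1)]
      have "dBL \<mu> (empirical_measure (M N) x) \<le> dBL \<mu> (empirical_measure (M N) y) + dBL (empirical_measure (M N) y) (empirical_measure (M N) x)"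
        by (rule BL.triangle[OF \<mu> P P])
      also have "\<dots> < \<rho> / 2 + \<rho> / 2"
      proof (rule add_less_le_mono)
        show "dBL \<mu> (empirical_measure (M N) y) < \<rho> / 2"
          using y(4) by (simp only: BL.commute)
        have "dBL (empirical_measure (M N) x) (empirical_measure (M N) y) \<le> 2 * r"
          by (rule dBL_empirical_measure_le[OF m(1)]) (rule x)
        then show "dBL (empirical_measure (M N) y) (empirical_measure (M N) x) \<le> \<rho> / 2"
          using r(3) by (simp only: BL.commute)
      qed
      finally have "empirical_measure (M N) x \<in> BL.mball \<mu> \<rho>"
        using \<mu> P by (simp only: BL.in_mball) simp
      then show ?thesis using \<rho> by blast
    qed
    define a where "a = real N * real (M N)"
    have a: "0 \<le> a" by (simp add: a_def)
    have "(r + 2 * (real (M N) / real N)) * (4 * v + 8) \<le> \<eta> / 4 + \<eta> / 4"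
      using rv elim(3) by (simp only: distrib_right mult_ac)
    then have "a * (v + (r + 2 * (real (M N) / real N)) * (4 * v + 8)) \<le> a * (v + \<eta> / 2)"
      using a by (intro mult_left_mono) auto
    then have 1: "exp (- a * (v + \<eta> / 2)) \<le> exp (- a * (v + (r + 2 * (real (M N) / real N)) * (4 * v + 8)))"
      by simp
    have "(r / 2 / exp 1) ^ (2 * (M N)^2) = exp (- (real (2 * (M N)^2) * L))"
    proof -
      have "r / 2 / exp 1 = exp (- L)" using r by (simp add: L_def)
      then show ?thesis by (simp only: exp_of_nat_mult[symmetric]) simp
    qed
    moreover have "real (2 * (M N)^2) * L \<le> a * (\<eta> / 4)"
    proof -
      have "a * (real (M N) / real N * (2 * L)) \<le> a * (\<eta> / 4)"
        using elim(4) a by (intro mult_left_mono) auto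
      then show ?thesis using elim(5) by (simp add: a_def power2_eq_square)
    qed
    ultimately have 2: "exp (- a * (\<eta> / 4)) \<le> (r / 2 / exp 1) ^ (2 * (M N)^2)" by simp
    have "ln (2 * real (M N) / r) \<le> ln (2 * real N / r)"
      using m r by (subst ln_le_cancel_iff) (auto simp: divide_right_mono)
    then have "real (M N) * ln (2 * real (M N) / r) \<le> real (M N) * (real N * (\<eta> / 4))"
      using elim(1) by (intro mult_left_mono) auto
    moreover have "(r / (2 * real (M N))) ^ M N = exp (- (real (M N) * ln (2 * real (M N) / r)))"
    proof -
      have "r / (2 * real (M N)) = exp (- ln (2 * real (M N) / r))"
        using r m by (simp add: exp_minus)
      then show ?thesis by (simp only: exp_of_nat_mult[symmetric]) simp
    qed
    ultimately have 3: "exp (- a * (\<eta> / 4)) \<le> (r / (2 * real (M N))) ^ M N"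
      by (simp add: a_def mult_ac)
    have "exp (- a * (v + \<eta>)) = exp (- a * (v + \<eta> / 2)) * exp (- a * (\<eta> / 4)) * exp (- a * (\<eta> / 4))"
      unfolding mult_exp_exp by (simp add: algebra_simps)
    also have "\<dots> \<le> exp (- a * (v + (r + 2 * (real (M N) / real N)) * (4 * v + 8)))
      * (r / 2 / exp 1) ^ (2 * (M N)^2) * (r / (2 * real (M N))) ^ M N"
      using r by (intro mult_mono 1 2 3) auto
    finally have "ennreal (exp (- a * (v + \<eta>))) \<le> ennreal (exp (- a * (v + (r + 2 * (real (M N) / real N)) * (4 * v + 8)))
      * (r / 2 / exp 1) ^ (2 * (M N)^2) * (r / (2 * real (M N))) ^ M N)"
      by (rule ennreal_leI)
    also have "\<dots> \<le> mass N (M N) U"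
      unfolding a_def by (rule mass_ge[OF r(1,2) m y(1) _ y(3) in_U]) (use y(2) in blast)
    finally show ?case unfolding a_def .
  qed
qed

lemma eventually_total_mass_le:
  assumes "0 < \<eta>"
  shows "\<forall>\<^sub>F N in sequentially. mass N (M N) UNIV \<le> ennreal (exp (- (real N * real (M N)) * (1 - ln 2 - \<eta>)))"
proof -
  have "\<forall>\<^sub>F N in sequentially. mass N (M N) real_prob_measures \<le> ennreal (exp (- (real N * real (M N)) * (1 - ln 2 - \<eta>)))"
    using min_potential_pos by (intro eventually_mass_le energy_ge_min assms) linarith+
  then show ?thesis
    using eventually_ge_at_top[of "1::nat"] by eventually_elim (use range_M mass_topspace in simp)
qed

lemma eventually_total_mass_ge:
  assumes "0 < \<eta>"
  shows "\<forall>\<^sub>F N in sequentially. ennreal (exp (- (real N * real (M N)) * (1 - ln 2 + \<eta>))) \<le> mass N (M N) UNIV"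
proof -
  \<comment> \<open>any minimiser of the energy\<close>
  let ?\<mu> = "mixture 0 (return borel (- sqrt 2)) (return borel (sqrt 2))"
  have \<mu>: "?\<mu> \<in> real_prob_measures"
    by (intro mixture_in_real_prob_measures return_in_real_prob_measures) simp
  have "energy ?\<mu> = ennreal (1 - ln 2)" by (rule energy_two_point) simp
  also have "\<dots> < ennreal (1 - ln 2 + \<eta> / 2)"
    using assms min_potential_pos by (intro ennreal_lessI) linarith+
  finally have ge: "\<forall>\<^sub>F N in sequentially. ennreal (exp (- (real N * real (M N)) * (1 - ln 2 + \<eta> / 2 + \<eta> / 2))) \<le> mass N (M N) real_prob_measures"
    using openin_topspace[of prob_topology] \<mu> assms by (intro eventually_mass_ge[of _ ?\<mu>]) simp_all
  have eq: "1 - ln 2 + \<eta> / 2 + \<eta> / 2 = 1 - ln 2 + \<eta>" by simp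
  show ?thesis
    using ge[unfolded eq] eventually_ge_at_top[of "1::nat"]
    by eventually_elim (use range_M mass_topspace in simp)
qed

lemma speed_at_top: "filterlim (\<lambda>N. real N * real (M N)) at_top sequentially"
proof (rule filterlim_at_top_mono[OF filterlim_real_sequentially])
  show "\<forall>\<^sub>F N in sequentially. real N \<le> real N * real (M N)"
    using eventually_ge_at_top[of "1::nat"]
  proof eventually_elim
    case (elim N)
    have "real N * 1 \<le> real N * real (M N)" using range_M[OF elim] by (intro mult_left_mono) auto
    then show ?case by simp
  qed
qed

lemma ldp_upper_bound:
  assumes F: "F \<in> sets (borel_of prob_topology)" and c: "0 \<le> c" "\<And>\<mu>. \<mu> \<in> F \<Longrightarrow> ennreal c \<le> energy \<mu>"
  shows "limsup (\<lambda>N. ereal (1 / (real N * real (M N))) * elog (measure (empirical_law N (M N)) F)) \<le> ereal (1 - ln 2 - c)"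
proof (rule ereal_le_epsilon2)
  fix \<epsilon> :: real assume "0 < \<epsilon>"
  define \<eta> where "\<eta> = \<epsilon> / 2"
  have \<eta>: "0 < \<eta>" using \<open>0 < \<epsilon>\<close> by (simp add: \<eta>_def)
  have le: "\<forall>\<^sub>F N in sequentially. mass N (M N) F \<le> ennreal (exp (- (real N * real (M N)) * (c - \<eta>)))"
    by (rule eventually_mass_le[OF c(1) _ \<eta>]) (rule c(2))
  have "\<forall>\<^sub>F N in sequentially. ereal (1 / (real N * real (M N))) * elog (measure (empirical_law N (M N)) F)
    \<le> ereal (- (c - (1 - ln 2) - \<epsilon>))"
    using le eventually_total_mass_ge[OF \<eta>] eventually_ge_at_top[of "1::nat"]
  proof eventually_elim
    case (elim N)
    have m: "1 \<le> M N" "M N \<le> N" using range_M[OF elim(3)] by auto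
    define a where "a = real N * real (M N)"
    have a: "0 < a" using m by (simp add: a_def)
    have 1: "enn2real (mass N (M N) F) \<le> exp (- a * (c - \<eta>))"
      using elim(1) unfolding a_def by (intro enn2real_leI) auto
    have 2: "exp (- a * (1 - ln 2 + \<eta>)) \<le> enn2real (mass N (M N) UNIV)"
      using elim(2) mass_finite[OF m, of UNIV] unfolding a_def[symmetric]
      by (subst enn2real_ennreal[symmetric], simp) (intro enn2real_mono, simp_all)
    have "measure (empirical_law N (M N)) F \<le> exp (- a * (c - \<eta>)) / exp (- a * (1 - ln 2 + \<eta>))"
      unfolding measure_empirical_law[OF m F] by (intro frac_le 1 2) auto
    also have "\<dots> = exp (- a * (c - (1 - ln 2) - \<epsilon>))"
      unfolding exp_diff[symmetric] by (simp add: \<eta>_def algebra_simps)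
    finally show ?case
      unfolding a_def[symmetric] by (intro scaled_elog_le a) auto
  qed
  then have "limsup (\<lambda>N. ereal (1 / (real N * real (M N))) * elog (measure (empirical_law N (M N)) F))
    \<le> ereal (- (c - (1 - ln 2) - \<epsilon>))"
    by (rule Limsup_bounded)
  then show "limsup (\<lambda>N. ereal (1 / (real N * real (M N))) * elog (measure (empirical_law N (M N)) F))
    \<le> ereal (1 - ln 2 - c) + ereal \<epsilon>"
    by (simp add: algebra_simps)
qed

lemma ldp_lower_bound:
  assumes U: "openin prob_topology U" "\<mu> \<in> U" and e: "energy \<mu> = ennreal e" "0 \<le> e"
  shows "ereal (1 - ln 2 - e) \<le> liminf (\<lambda>N. ereal (1 / (real N * real (M N))) * elog (measure (empirical_law N (M N)) U))"
proof (rule ereal_le_epsilon2)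
  fix \<epsilon> :: real assume "0 < \<epsilon>"
  define \<eta> where "\<eta> = \<epsilon> / 3"
  have \<eta>: "0 < \<eta>" using \<open>0 < \<epsilon>\<close> by (simp add: \<eta>_def)
  have v: "energy \<mu> < ennreal (e + \<eta>)" using e \<eta> by (simp add: ennreal_lessI)
  note UB = openin_sets_borel_of[OF U(1)]
  have "\<forall>\<^sub>F N in sequentially. ereal (- (e - (1 - ln 2) + \<epsilon>))
    \<le> ereal (1 / (real N * real (M N))) * elog (measure (empirical_law N (M N)) U)"
    using eventually_mass_ge[OF U v \<eta>] eventually_total_mass_le[OF \<eta>] eventually_ge_at_top[of "1::nat"]
  proof eventually_elim
    case (elim N)
    have m: "1 \<le> M N" "M N \<le> N" using range_M[OF elim(3)] by auto
    define a where "a = real N * real (M N)"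
    have a: "0 < a" using m by (simp add: a_def)
    have 1: "exp (- a * (e + \<eta> + \<eta>)) \<le> enn2real (mass N (M N) U)"
      using elim(1) mass_finite[OF m, of U] unfolding a_def[symmetric]
      by (subst enn2real_ennreal[symmetric], simp) (intro enn2real_mono, simp_all)
    have 2: "enn2real (mass N (M N) UNIV) \<le> exp (- a * (1 - ln 2 - \<eta>))"
      using elim(2) unfolding a_def by (intro enn2real_leI) auto
    have 3: "0 < enn2real (mass N (M N) UNIV)"
      using mass_pos[OF m] mass_finite[OF m, of UNIV] by (simp add: enn2real_positive_iff)
    have "exp (- a * (e - (1 - ln 2) + \<epsilon>)) = exp (- a * (e + \<eta> + \<eta>)) / exp (- a * (1 - ln 2 - \<eta>))"
      unfolding exp_diff[symmetric] by (simp add: \<eta>_def algebra_simps)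
    also have "\<dots> \<le> measure (empirical_law N (M N)) U"
      unfolding measure_empirical_law[OF m UB] by (intro frac_le 1 2 3) auto
    finally show ?case
      unfolding a_def[symmetric] by (intro scaled_elog_ge a)
  qed
  then have "ereal (- (e - (1 - ln 2) + \<epsilon>))
    \<le> liminf (\<lambda>N. ereal (1 / (real N * real (M N))) * elog (measure (empirical_law N (M N)) U))"
    by (rule Liminf_bounded)
  then have "ereal (- (e - (1 - ln 2) + \<epsilon>)) + ereal \<epsilon>
    \<le> liminf (\<lambda>N. ereal (1 / (real N * real (M N))) * elog (measure (empirical_law N (M N)) U)) + ereal \<epsilon>"
    by (rule add_right_mono)
  then show "ereal (1 - ln 2 - e)
    \<le> liminf (\<lambda>N. ereal (1 / (real N * real (M N))) * elog (measure (empirical_law N (M N)) U)) + ereal \<epsilon>"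
    by (simp add: algebra_simps)
qed

lemma satisfies_ldp_empirical_law:
  "satisfies_ldp prob_topology (\<lambda>N. empirical_law N (M N)) (\<lambda>N. real N * real (M N)) I_rate"
  unfolding satisfies_ldp_def
proof (intro conjI allI impI)
  fix N :: nat assume "1 \<le> N"
  then show "prob_space (empirical_law N (M N))"
    using range_M by (intro prob_space_empirical_law) auto
  show "sets (empirical_law N (M N)) = sets (borel_of prob_topology)"
    by (rule sets_empirical_law)
next
  show "filterlim (\<lambda>N. real N * real (M N)) at_top sequentially" by (rule speed_at_top)
  show "rate_function prob_topology I_rate"
    using good_rate_function_I_rate by (simp only: good_rate_function_def)
next
  fix U assume U: "openin prob_topology U"
  let ?L = "liminf (\<lambda>N. ereal (1 / (real N * real (M N))) * elog (measure (empirical_law N (M N)) U))"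
  have "- ?L \<le> (INF \<mu>\<in>U. I_rate \<mu>)"
  proof (rule INF_greatest)
    fix \<mu> assume \<mu>: "\<mu> \<in> U"
    show "- ?L \<le> I_rate \<mu>"
    proof (cases "energy \<mu>")
      case (real e)
      have "- ?L \<le> - ereal (1 - ln 2 - e)"
        unfolding ereal_minus_le_minus by (rule ldp_lower_bound[OF U \<mu> real(2,1)])
      also have "\<dots> = I_rate \<mu>"
        unfolding I_rate_eq real using real(1) by (simp add: enn2ereal_ennreal)
      finally show ?thesis .
    next
      case top
      then have "I_rate \<mu> = \<infinity>" by (simp add: I_rate_eq top_ennreal.rep_eq top_ereal_def)
      then show ?thesis by simp
    qed
  qed
  then show "- (INF \<mu>\<in>U. I_rate \<mu>) \<le> ?L"
    by (rule ereal_uminus_le_reorder[THEN iffD1])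
next
  fix F assume F: "closedin prob_topology F"
  let ?L = "limsup (\<lambda>N. ereal (1 / (real N * real (M N))) * elog (measure (empirical_law N (M N)) F))"
  show "?L \<le> - (INF \<mu>\<in>F. I_rate \<mu>)"
  proof (rule ccontr)
    assume "\<not> ?L \<le> - (INF \<mu>\<in>F. I_rate \<mu>)"
    then obtain z where z: "- (INF \<mu>\<in>F. I_rate \<mu>) < ereal z" "ereal z < ?L"
      using ereal_dense2 by (meson not_le)
    \<comment> \<open>the energy level that \<open>z\<close> corresponds to, cut off at 0 to remain a level in \<open>ennreal\<close>\<close>
    define c where "c = max 0 (1 - ln 2 - z)"
    have "ennreal c \<le> energy \<mu>" if "\<mu> \<in> F" for \<mu>
    proof -
      have "ereal (- z) \<le> (INF \<mu>\<in>F. I_rate \<mu>)"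
        using ereal_uminus_le_reorder[THEN iffD1, OF less_imp_le[OF z(1)]] by simp
      also have "\<dots> \<le> I_rate \<mu>" using that by (rule INF_lower)
      finally have "ereal (1 - ln 2 - z) \<le> enn2ereal (energy \<mu>)"
        unfolding I_rate_eq by (cases "enn2ereal (energy \<mu>)") auto
      then have "ereal c \<le> enn2ereal (energy \<mu>)" 
        using enn2ereal_nonneg[of "energy \<mu>"] by (simp add: c_def max_def zero_ereal_def)
      moreover have "0 \<le> c" by (simp add: c_def)
      ultimately show ?thesis by (simp only: less_eq_ennreal.rep_eq enn2ereal_ennreal)
    qed
    then have "?L \<le> ereal (1 - ln 2 - c)"
      by (intro ldp_upper_bound closedin_sets_borel_of F) (simp_all add: c_def)
    also have "\<dots> \<le> ereal z" by (simp add: c_def)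
    finally show False using z(2) by simp
  qed
qed

end

theorem theorem1p3:
  fixes M :: "nat \<Rightarrow> nat"
  assumes "\<And>N. 1 \<le> N \<Longrightarrow> 1 \<le> M N \<and> M N \<le> N"
    and "filterlim M at_top sequentially"
    and "(\<lambda>N. real (M N) / real N) \<longlonglongrightarrow> 0"
  shows "satisfies_ldp prob_topology (\<lambda>N. empirical_law N (M N))
           (\<lambda>N. real N * real (M N)) I_rate \<and>
         good_rate_function prob_topology I_rate \<and>
         (\<forall>p\<in>{0..1}. is_arg_min I_rate (\<lambda>\<mu>. \<mu> \<in> real_prob_measures)
            (mixture p (return borel (- sqrt 2)) (return borel (sqrt 2)))) \<and>
         \<not> (\<exists>!\<mu>. is_arg_min I_rate (\<lambda>\<nu>. \<nu> \<in> real_prob_measures) \<mu>)"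
proof -
  interpret sublinear_size M
    using assms by unfold_locales blast+
  have "mixture 0 (return borel (- sqrt 2)) (return borel (sqrt 2)) = mixture 1 (return borel (- sqrt 2)) (return borel (sqrt 2))"
    if "\<exists>!\<mu>. is_arg_min I_rate (\<lambda>\<nu>. \<nu> \<in> real_prob_measures) \<mu>"
    using ex1_implies_ex that two_point_is_arg_min[of 0] two_point_is_arg_min[of 1] by auto
  then show ?thesis
    using satisfies_ldp_empirical_law good_rate_function_I_rate two_point_is_arg_min two_point_distinct by blast
qed

end
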